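(* For any $r \leq \mathrm{polylog}\, n$, the problem of computing a sparse $r$-neighborhood cover of an $n$-node graph is $\mathsf{P}$-$\mathsf{SLOCAL}$-complete.
   Context: For a graph $G=(V,E)$ and integer $r\ge1$, a sparse $r$-neighborhood cover is a collection of clusters $C_1,\dots,C_k\subseteq V$ such that each cluster has diameter at most $r\cdot\mathrm{polylog}\, n$, each $r$-hop neighborhood of a node of $G$ is completely contained in at least one cluster, and every node is contained in at most $\mathrm{polylog}\, n$ clusters. $G$ is the communication network. $\mathsf{P}$-$\mathsf{SLOCAL}$ is the class of problems solvable by a deterministic SLOCAL algorithm with locality $\mathrm{polylog}\, n$ (nodes processed sequentially in an arbitrary order, each reading its $\mathrm{polylog}\, n$-hop neighborhood including information stored by previously processed nodes). A problem $\mathcal A$ is $\mathsf{P}$-$\mathsf{SLOCAL}$-complete if $\mathcal A\in\mathsf{P}$-$\mathsf{SLOCAL}$ and, if $\mathcal A$ had a deterministic LOCAL algorithm with $\mathrm{polylog}\, n$ rounds, then every problem in $\mathsf{P}$-$\mathsf{SLOCAL}$ would have one. *)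

theory Defs
  imports
    Complex_Main
    "HOL-Library.FuncSet"
    "HOL-Library.Extended_Nat"
    "HOL-Library.Nat_Bijection"
    "HOL-Library.Landau_Symbols"
begin

definition polylog :: "(nat \<Rightarrow> nat) \<Rightarrow> bool" where
  "polylog f \<longleftrightarrow> (\<exists>k::nat. (\<lambda>n. real (f n)) \<in> O(\<lambda>n. ln (real n) ^ k))"


section \<open>Graphs\<close>

record graph =
  verts :: "nat set"
  edges :: "nat set set"

definition simple_graph :: "graph \<Rightarrow> bool" where
  "simple_graph G \<longleftrightarrow> finite (verts G) \<and> (\<forall>e\<in>edges G. e \<subseteq> verts G \<and> card e = 2)"

definition neighbors :: "graph \<Rightarrow> nat \<Rightarrow> nat set" where
  "neighbors G v = {u. {v, u} \<in> edges G}"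

text \<open>Infimum of the lengths of the walks from u to v; it is \<infinity> if there is no walk.\<close>

definition gdist :: "graph \<Rightarrow> nat \<Rightarrow> nat \<Rightarrow> enat" where
  "gdist G u v = Inf {enat i | i. (u, v) \<in> {(a, b). {a, b} \<in> edges G} ^^ i}"

definition diameter :: "graph \<Rightarrow> enat" where
  "diameter G = (SUP u\<in>verts G. SUP v\<in>verts G. gdist G u v)"

definition hop_ball :: "graph \<Rightarrow> nat \<Rightarrow> nat \<Rightarrow> nat set" where
  "hop_ball G k v = {u \<in> verts G. gdist G v u \<le> enat k}"

definition induced :: "graph \<Rightarrow> nat set \<Rightarrow> graph" where
  "induced G C = \<lparr>verts = verts G \<inter> C, edges = {e \<in> edges G. e \<subseteq> C}\<rparr>"


section \<open>Distributed graph problems\<close>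

text \<open>
  Inputs, outputs, messages and memory contents are natural numbers, standing for
  bit strings of unbounded length.  A problem consists of the instances (graph and node inputs)
  on which it has to be solved and of the admissible outputs for them.
\<close>

type_synonym labelling = "nat \<Rightarrow> nat"

record problem =
  instances :: "graph \<Rightarrow> labelling \<Rightarrow> bool"
  admissible :: "graph \<Rightarrow> labelling \<Rightarrow> labelling \<Rightarrow> bool"

text \<open>
  Unique identifiers of O(log n) bits, i.e. from a space of size n to the power c.  The names of the
  vertices in a graph are never visible to an algorithm, only the identifiers are.
\<close>

definition id_assignment :: "nat \<Rightarrow> graph \<Rightarrow> labelling \<Rightarrow> bool" where
  "id_assignment c G ident \<longleftrightarrow>
     inj_on ident (verts G) \<and> ident ` verts G \<subseteq> {..< card (verts G) ^ c}"


section \<open>The LOCAL model\<close>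

text \<open>
  Initially a node knows n, its identifier and its input.  In a round it sends to each
  neighbor a message depending on its state and on the neighbor's identifier, and then updates its
  state from the set of pairs (sender identifier, message) that it received.  There is no
  restriction on the local computations.
\<close>

record local_alg =
  l_init :: "nat \<Rightarrow> nat \<Rightarrow> nat \<Rightarrow> nat"
  l_send :: "nat \<Rightarrow> nat \<Rightarrow> nat"
  l_update :: "nat \<Rightarrow> (nat \<times> nat) set \<Rightarrow> nat"
  l_output :: "nat \<Rightarrow> nat"

primrec local_state ::
  "local_alg \<Rightarrow> graph \<Rightarrow> labelling \<Rightarrow> labelling \<Rightarrow> nat \<Rightarrow> nat \<Rightarrow> nat" where
  "local_state A G ident x 0 = (\<lambda>v. l_init A (card (verts G)) (ident v) (x v))"
| "local_state A G ident x (Suc k) =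
     (\<lambda>v. l_update A (local_state A G ident x k v)
            ((\<lambda>u. (ident u, l_send A (local_state A G ident x k u) (ident v))) ` neighbors G v))"

definition local_result ::
  "local_alg \<Rightarrow> nat \<Rightarrow> graph \<Rightarrow> labelling \<Rightarrow> labelling \<Rightarrow> labelling" where
  "local_result A T G ident x = (\<lambda>v\<in>verts G. l_output A (local_state A G ident x T v))"

definition P_LOCAL :: "problem set" where
  "P_LOCAL = {P. \<forall>c. \<exists>A t. polylog t \<and>
     (\<forall>G ident x. simple_graph G \<longrightarrow> id_assignment c G ident \<longrightarrow> instances P G x \<longrightarrow>
        admissible P G x (local_result A (t (card (verts G))) G ident x))}"


section \<open>The SLOCAL model\<close>

text \<open>
  What a node reads when it is processed: its own identifier; for every node of its neighborhood
  the identifier, the input and the stored information (None if that node has not been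
  processed yet); and the edges of the neighborhood in terms of identifiers.
\<close>

type_synonym view = "nat \<times> (nat \<times> nat \<times> nat option) set \<times> nat set set"

definition slocal_view ::
  "nat \<Rightarrow> graph \<Rightarrow> labelling \<Rightarrow> labelling \<Rightarrow> (nat \<rightharpoonup> nat) \<Rightarrow> nat \<Rightarrow> view" where
  "slocal_view T G ident x mem v =
     (ident v,
      (\<lambda>u. (ident u, x u, mem u)) ` hop_ball G T v,
      (\<lambda>e. ident ` e) ` edges (induced G (hop_ball G T v)))"

text \<open>
  The first argument of the storing function is n.  The output of a node is part of what it
  stores when it is processed.
\<close>

record slocal_alg =
  s_store :: "nat \<Rightarrow> view \<Rightarrow> nat"
  s_output :: "nat \<Rightarrow> nat"

definition slocal_memory ::
  "slocal_alg \<Rightarrow> nat \<Rightarrow> graph \<Rightarrow> labelling \<Rightarrow> labelling \<Rightarrow> nat list \<Rightarrow> (nat \<rightharpoonup> nat)" where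
  "slocal_memory A T G ident x vs =
     foldl (\<lambda>mem v. mem(v \<mapsto> s_store A (card (verts G)) (slocal_view T G ident x mem v)))
       Map.empty vs"

definition slocal_result ::
  "slocal_alg \<Rightarrow> nat \<Rightarrow> graph \<Rightarrow> labelling \<Rightarrow> labelling \<Rightarrow> nat list \<Rightarrow> labelling" where
  "slocal_result A T G ident x vs =
     (\<lambda>v\<in>verts G. s_output A (the (slocal_memory A T G ident x vs v)))"

definition P_SLOCAL :: "problem set" where
  "P_SLOCAL = {P. \<forall>c. \<exists>A t. polylog t \<and>
     (\<forall>G ident x vs. simple_graph G \<longrightarrow> id_assignment c G ident \<longrightarrow> instances P G x \<longrightarrow>
        distinct vs \<longrightarrow> set vs = verts G \<longrightarrow>
        admissible P G x (slocal_result A (t (card (verts G))) G ident x vs))}"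

text \<open>
  A problem whose specification contains unspecified polylogarithmic bounds is given by the set of
  its instantiations, one for each choice of the bounds; solving it means solving it for some choice
  of the bounds.  A fully specified problem is a singleton.
\<close>

definition P_SLOCAL_complete :: "problem set \<Rightarrow> bool" where
  "P_SLOCAL_complete \<A> \<longleftrightarrow>
     (\<exists>P\<in>\<A>. P \<in> P_SLOCAL) \<and> ((\<exists>P\<in>\<A>. P \<in> P_LOCAL) \<longrightarrow> (\<forall>Q\<in>P_SLOCAL. Q \<in> P_LOCAL))"


section \<open>Sparse neighborhood covers\<close>

text \<open>
  The clusters are a finite indexed family; the diameter of a cluster is that of the subgraph it
  induces (so clusters are connected).
\<close>

definition neighborhood_cover ::
  "graph \<Rightarrow> nat \<Rightarrow> nat \<Rightarrow> nat \<Rightarrow> nat set \<Rightarrow> (nat \<Rightarrow> nat set) \<Rightarrow> bool" where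
  "neighborhood_cover G r D s J C \<longleftrightarrow>
     finite J \<and>
     (\<forall>j\<in>J. C j \<subseteq> verts G \<and> diameter (induced G (C j)) \<le> enat D) \<and>
     (\<forall>v\<in>verts G. \<exists>j\<in>J. hop_ball G r v \<subseteq> C j) \<and>
     (\<forall>v\<in>verts G. card {j \<in> J. v \<in> C j} \<le> s)"

text \<open>
  There is no input (all inputs are 0).  A node outputs the finite set of the names of the clusters
  containing it, encoded as a natural number whose binary digits are its characteristic function.
\<close>

definition cover_problem :: "(nat \<Rightarrow> nat) \<Rightarrow> (nat \<Rightarrow> nat) \<Rightarrow> (nat \<Rightarrow> nat) \<Rightarrow> problem" where
  "cover_problem r d s =
     \<lparr>instances = (\<lambda>G x. \<forall>v\<in>verts G. x v = 0),
      admissible = (\<lambda>G x y.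
        let n = card (verts G) in
        neighborhood_cover G (r n) (r n * d n) (s n)
          (\<Union>v\<in>verts G. set_decode (y v))
          (\<lambda>j. {v \<in> verts G. j \<in> set_decode (y v)}))\<rparr>"

definition sparse_neighborhood_cover :: "(nat \<Rightarrow> nat) \<Rightarrow> problem set" where
  "sparse_neighborhood_cover r = {cover_problem r d s | d s. polylog d \<and> polylog s}"

end

theory Submission imports Defs "HOL-Library.Discrete_Functions"
begin

text \<open>
  Completeness holds because every SLOCAL algorithm with polylogarithmic locality t has a LOCAL
  counterpart, whether or not covers are easy.  The deterministic network decomposition of Rozhon and
  Ghaffari is used for the graph in which nodes at distance at most t are adjacent.  Every node starts
  as its own cluster, named by its identifier.  The bits of the names are treated one after the other:
  clusters with bit 0 are red, the others blue, and a blue node next to a red cluster asks to join it.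
  With b bits, a red cluster accepts if the requests enlarge it by a factor of at least 1 + 1/(2b);
  otherwise the nodes that asked are discarded, and the cluster never has blue neighbors again in this
  phase.  Hence adjacent surviving nodes end up in the same cluster, and at most half of the nodes are
  discarded.  Discarded nodes are treated again, with a new colour; a logarithmic number of colours
  suffices.  If the nodes are processed by increasing colour, the dependencies of a node leave its
  cluster only when the colour decreases, so it can simulate the whole process on a ball of
  polylogarithmic radius.

  To compute covers, a node that is processed in the SLOCAL model puts all nodes of its r-ball into disjoint
  cores; the clusters are the r-neighborhoods of the cores, so that the clusters containing the node do
  not change any more.  A core grows in steps of length 2r among the nodes that are still free for its
  colour, until the nodes of the next layer weigh at most as much as the core; these are then blocked
  for the colour.  The weight of a node is 2 to the number of colours for which it is blocked.  The
  total weight of the nodes outside the cores never increases, so that no weight exceeds n, and a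
  logarithmic number of colours and of growth steps suffices.  Cores of the same colour are more than
  2r apart, hence a node is contained in at most one cluster of each colour.
\<close>

section \<open>Distances\<close>

text \<open>Later arguments use this relation between numbers instead of \<open>gdist\<close>, so
  that infima and infinite distances occur only in the next lemma and where diameters are
  bounded.\<close>

definition near :: "graph \<Rightarrow> nat \<Rightarrow> nat \<Rightarrow> nat \<Rightarrow> bool" where
  "near G k u v \<longleftrightarrow> gdist G u v \<le> enat k"

lemma near_iff_relpow: "near G k u v \<longleftrightarrow> (\<exists>i\<le>k. (u, v) \<in> {(a, b). {a, b} \<in> edges G} ^^ i)"
proof
  assume a: "near G k u v"
  let ?S = "{enat i | i. (u, v) \<in> {(a, b). {a, b} \<in> edges G} ^^ i}"
  have le: "Inf ?S \<le> enat k" using a by (simp add: near_def gdist_def)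
  \<comment> \<open>The infimum of the empty set is infinite, so the finite bound forces a walk to
    exist, and the infimum is attained.\<close>
  have ne: "?S \<noteq> {}"
  proof
    assume "?S = {}"
    then have "Inf ?S = \<infinity>" unfolding Inf_enat_def by simp
    then show False using le by simp
  qed
  then have "Inf ?S \<in> ?S" unfolding Inf_enat_def using LeastI_ex[of "\<lambda>x. x \<in> ?S"] by auto
  then obtain i where "Inf ?S = enat i" "(u, v) \<in> {(a, b). {a, b} \<in> edges G} ^^ i" by blast
  with le show "\<exists>i\<le>k. (u, v) \<in> {(a, b). {a, b} \<in> edges G} ^^ i" by auto
next
  assume "\<exists>i\<le>k. (u, v) \<in> {(a, b). {a, b} \<in> edges G} ^^ i"
  then obtain i where i: "i \<le> k" "(u, v) \<in> {(a, b). {a, b} \<in> edges G} ^^ i" by blast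
  then have "gdist G u v \<le> enat i" unfolding gdist_def by (intro Inf_lower) auto
  also have "\<dots> \<le> enat k" using i by simp
  finally show "near G k u v" by (simp add: near_def)
qed

lemma hop_ball_near: "hop_ball G k v = {u \<in> verts G. near G k v u}"
  by (simp add: hop_ball_def near_def)

lemma near_refl [simp]: "near G k u u"
  by (auto simp: near_iff_relpow intro!: exI[of _ 0])

lemma near_0 [simp]: "near G 0 u v \<longleftrightarrow> u = v"
  by (auto simp: near_iff_relpow)

lemma near_mono: "near G i u v \<Longrightarrow> i \<le> j \<Longrightarrow> near G j u v"
  unfolding near_def by (erule order_trans) simp

lemma near_trans: "near G i u v \<Longrightarrow> near G j v w \<Longrightarrow> near G (i + j) u w"
  unfolding near_iff_relpow using add_mono relpow_trans by meson

lemma near_split: 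
  assumes "near G (i + j) u v"
  obtains w where "near G i u w" "near G j w v"
proof -
  obtain m where m: "m \<le> i + j" "(u, v) \<in> {(a, b). {a, b} \<in> edges G} ^^ m"
    using assms by (auto simp: near_iff_relpow)
  \<comment> \<open>The walk is cut after \<open>min m i\<close> steps; if it is shorter than
    \<open>i\<close>, the second piece is empty.\<close>
  have "m = min m i + (m - i)" by simp
  then have "(u, v) \<in> {(a, b). {a, b} \<in> edges G} ^^ min m i O {(a, b). {a, b} \<in> edges G} ^^ (m - i)"
    using m(2) by (metis relpow_add)
  moreover have "min m i \<le> i" "m - i \<le> j" using m(1) by auto
  ultimately show thesis using that unfolding near_iff_relpow by blast
qed

lemma near_edge: "{u, v} \<in> edges G \<Longrightarrow> near G 1 u v"
  by (auto simp: near_iff_relpow intro!: exI[of _ 1])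

lemma near_1: "near G 1 u v \<longleftrightarrow> u = v \<or> {u, v} \<in> edges G"
proof -
  have "(\<exists>i\<le>1. P i) \<longleftrightarrow> P 0 \<or> P (1::nat)" for P
    by (metis le_numeral_extra(3) less_one order_le_less zero_le_one)
  then show ?thesis by (simp add: near_iff_relpow)
qed

lemma near_Suc: "near G (Suc k) u v \<longleftrightarrow> near G k u v \<or> (\<exists>w. near G k u w \<and> {w, v} \<in> edges G)"
proof
  assume "near G (Suc k) u v"
  then obtain w where "near G k u w" "near G 1 w v" by (metis near_split Suc_eq_plus1)
  then show "near G k u v \<or> (\<exists>w. near G k u w \<and> {w, v} \<in> edges G)"
    unfolding near_1 by blast
next
  assume "near G k u v \<or> (\<exists>w. near G k u w \<and> {w, v} \<in> edges G)"
  then show "near G (Suc k) u v"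
  proof
    assume "\<exists>w. near G k u w \<and> {w, v} \<in> edges G"
    then show ?thesis using near_trans[OF _ near_edge, of G k u _ v] by auto
  qed (rule near_mono[of G k u v "Suc k"], simp_all)
qed

lemma near_sym: "near G k u v \<Longrightarrow> near G k v u"
proof (induction k arbitrary: v)
  case (Suc k)
  from Suc.prems consider "near G k u v" | w where "near G k u w" "{w, v} \<in> edges G"
    by (auto simp: near_Suc)
  then show ?case
  proof cases
    case 1
    then show ?thesis using Suc.IH near_mono le_SucI by blast
  next
    case 2
    then have "near G 1 v w" unfolding near_1 by (simp add: insert_commute)
    from near_trans[OF this Suc.IH[OF 2(1)]] show ?thesis by simp
  qed
qed simp

lemma near_Suc2: "near G (Suc k) u v \<longleftrightarrow> near G k u v \<or> (\<exists>w. {u, w} \<in> edges G \<and> near G k w v)"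
  by (metis near_Suc near_sym insert_commute)

lemma near_verts: "simple_graph G \<Longrightarrow> near G k u v \<Longrightarrow> u \<in> verts G \<longleftrightarrow> v \<in> verts G"
proof (induction k arbitrary: v)
  case (Suc k)
  then show ?case by (auto simp: near_Suc simple_graph_def)
qed simp

lemma near_edges_mono: "edges G \<subseteq> edges H \<Longrightarrow> near G k u v \<Longrightarrow> near H k u v"
  by (induction k arbitrary: v) (auto simp: near_Suc)

lemma self_in_hop_ball: "v \<in> verts G \<Longrightarrow> v \<in> hop_ball G k v"
  by (simp add: hop_ball_near)

lemma finite_hop_ball: "simple_graph G \<Longrightarrow> finite (hop_ball G k v)"
  by (simp add: hop_ball_near simple_graph_def)

lemma hop_ball_mono: "i \<le> j \<Longrightarrow> hop_ball G i v \<subseteq> hop_ball G j v"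
  by (auto simp: hop_ball_near intro: near_mono)


section \<open>Functions that depend on bounded neighborhoods only\<close>

text \<open>Equality instead of isomorphism is enough, since vertices will be renamed by their
  identifiers. Edges between two nodes at distance exactly \<open>T\<close> are included; they cost
  the LOCAL simulation one additional round.\<close>

definition agree :: "nat \<Rightarrow> nat \<Rightarrow> graph \<Rightarrow> graph \<Rightarrow> bool" where
  "agree T v G G' \<longleftrightarrow> hop_ball G T v = hop_ball G' T v \<and>
     (\<forall>e. e \<subseteq> hop_ball G T v \<longrightarrow> (e \<in> edges G \<longleftrightarrow> e \<in> edges G'))"

lemma agree_sym: "agree T v G G' \<Longrightarrow> agree T v G' G"
  by (auto simp: agree_def)

lemma agree_hop_ball_eq: "agree T v G G' \<Longrightarrow> hop_ball G T v = hop_ball G' T v"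
  by (simp add: agree_def)

lemma agree_verts:
  assumes "agree T v G G'" "w \<in> hop_ball G T v"
  shows "w \<in> verts G'"
proof -
  have "w \<in> hop_ball G' T v" using assms agree_hop_ball_eq by blast
  then show ?thesis by (simp add: hop_ball_near)
qed

lemma agree_edges: "agree T v G G' \<Longrightarrow> e \<subseteq> hop_ball G T v \<Longrightarrow> e \<in> edges G \<longleftrightarrow> e \<in> edges G'"
  by (simp add: agree_def)

text \<open>Every node on a walk of length \<open>j\<close> from \<open>u\<close> is within
  \<open>i + j\<close> of \<open>v\<close>, so all edges of the walk lie in the ball on which the
  graphs coincide.\<close>

lemma agree_near_imp:
  assumes G: "simple_graph G" "v \<in> verts G" and ag: "agree T v G G'"
    and u: "near G i v u" and w: "near G j u w" and T: "i + j \<le> T"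
  shows "near G' j u w"
  using w T
proof (induction j arbitrary: w)
  case (Suc j)
  show ?case
  proof (cases "near G j u w")
    case True
    then show ?thesis using Suc near_mono by fastforce
  next
    case False
    then obtain z where z: "near G j u z" "{z, w} \<in> edges G" using Suc.prems by (auto simp: near_Suc)
    have "near G (i + j) v z" using near_trans[OF u z(1)] .
    moreover have "near G (i + Suc j) v w" using near_trans[OF u Suc.prems(1)] .
    ultimately have "{z, w} \<subseteq> hop_ball G T v"
      using Suc.prems G z(2) by (auto simp: hop_ball_near simple_graph_def intro: near_mono)
    then have "{z, w} \<in> edges G'" using agree_edges[OF ag] z(2) by blast
    moreover have "near G' j u z" using Suc.IH z(1) Suc.prems(2) by simp
    ultimately show ?thesis by (auto simp: near_Suc)
  qed
qed simp

lemma agree_near: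
  assumes "simple_graph G" "simple_graph G'" "v \<in> verts G" "agree T v G G'"
    "near G i v u" "i + j \<le> T"
  shows "near G j u w \<longleftrightarrow> near G' j u w"
proof -
  have v: "v \<in> verts G'" using agree_verts[OF assms(4) self_in_hop_ball[OF assms(3)]] .
  have u: "near G' i v u" 
    by (rule agree_near_imp[where i = 0, OF assms(1,3,4) near_refl assms(5)]) (use assms(6) in simp)
  show ?thesis
  proof
    show "near G j u w \<Longrightarrow> near G' j u w" by (rule agree_near_imp[OF assms(1,3,4,5) _ assms(6)])
    show "near G' j u w \<Longrightarrow> near G j u w"
      by (rule agree_near_imp[OF assms(2) v agree_sym[OF assms(4)] u _ assms(6)])
  qed
qed

lemma agree_hop_ball:
  assumes "simple_graph G" "simple_graph G'" "v \<in> verts G" "agree T v G G'"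
    "near G i v u" "i + j \<le> T"
  shows "hop_ball G j u = hop_ball G' j u"
proof -
  have "hop_ball G j u \<subseteq> hop_ball G' j u"
    if "simple_graph G" "simple_graph G'" "v \<in> verts G" "agree T v G G'" "near G i v u" for G G'
  proof
    fix w assume w: "w \<in> hop_ball G j u"
    then have "near G' j u w" using agree_near[OF that assms(6)] by (simp add: hop_ball_near)
    moreover have "near G (i + j) v w" using near_trans[OF that(5)] w by (simp add: hop_ball_near)
    then have "w \<in> hop_ball G T v" using w assms(6) by (auto simp: hop_ball_near intro: near_mono)
    then have "w \<in> verts G'" using agree_verts[OF that(4)] by blast
    ultimately show "w \<in> hop_ball G' j u" by (simp add: hop_ball_near)
  qed note sub = this
  have v: "v \<in> verts G'" using agree_verts[OF assms(4) self_in_hop_ball[OF assms(3)]] .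
  have u: "near G' i v u" 
    by (rule agree_near_imp[where i = 0, OF assms(1,3,4) near_refl assms(5)]) (use assms(6) in simp)
  show ?thesis
    by (rule equalityI[OF sub[OF assms(1-5)] sub[OF assms(2,1) v agree_sym[OF assms(4)] u]])
qed

lemma agree_shift:
  assumes "simple_graph G" "simple_graph G'" "v \<in> verts G" "agree T v G G'"
    "u \<in> hop_ball G i v" "i + j \<le> T"
  shows "agree j u G G'"
proof -
  have u: "near G i v u" using assms(5) by (simp add: hop_ball_near)
  have "hop_ball G j u \<subseteq> hop_ball G T v"
    using near_trans[OF u] assms(6) by (auto simp: hop_ball_near intro: near_mono)
  then show ?thesis using assms(4) agree_hop_ball[OF assms(1-4) u assms(6)]
    unfolding agree_def by auto
qed

text \<open>Criterion for a subgraph. It is applied to the graph that a node has collected in the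
  LOCAL model and to the graph that a node reads in the SLOCAL model.\<close>

lemma agreeI:
  assumes V: "verts G' \<subseteq> verts G" and E: "edges G' \<subseteq> edges G"
    and B: "hop_ball G T v \<subseteq> verts G'" and G: "simple_graph G" and v: "v \<in> verts G"
    and inner: "\<And>a b. {a, b} \<in> edges G \<Longrightarrow> a \<in> hop_ball G T v \<Longrightarrow> b \<in> hop_ball G T v \<Longrightarrow> {a, b} \<in> edges G'"
  shows "agree T v G G'"
proof -
  have w: "near G' j v u" if "near G j v u" "j \<le> T" for j u
    using that
  proof (induction j arbitrary: u)
    case (Suc j)
    show ?case
    proof (cases "near G j v u")
      case True
      then show ?thesis using Suc by (auto simp: near_Suc)
    next
      case False
      then obtain z where z: "near G j v z" "{z, u} \<in> edges G" using Suc.prems by (auto simp: near_Suc)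
      have "z \<in> hop_ball G T v" "u \<in> hop_ball G T v"
        using z Suc.prems G by (auto simp: hop_ball_near simple_graph_def intro: near_mono)
      then have "{z, u} \<in> edges G'" using inner z(2) by blast
      then show ?thesis using Suc.IH[OF z(1)] Suc.prems(2) by (auto simp: near_Suc)
    qed
  qed simp
  have hb: "hop_ball G T v = hop_ball G' T v"
    using w[of T] B V near_edges_mono[OF E] by (auto simp: hop_ball_near)
  have "e \<in> edges G'" if e: "e \<subseteq> hop_ball G T v" "e \<in> edges G" for e
  proof -
    have "card e = 2" using G e(2) by (simp add: simple_graph_def)
    then obtain a b where "e = {a, b}" by (auto simp: card_2_iff)
    then show ?thesis using inner e by auto
  qed
  then show ?thesis using hb E by (auto simp only: agree_def)
qed

text \<open>A form of bounded-round computation without messages. LOCAL algorithms are assembled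
  from such functions and turned into message passing only once, in
  \<open>gather_local_fun\<close>.\<close>

definition local_fun :: "nat \<Rightarrow> (graph \<Rightarrow> (nat \<Rightarrow> 'a) \<Rightarrow> nat \<Rightarrow> 'b) \<Rightarrow> bool" where
  "local_fun T F \<longleftrightarrow> (\<forall>G G' y y' v. simple_graph G \<longrightarrow> simple_graph G' \<longrightarrow> v \<in> verts G \<longrightarrow> agree T v G G' \<longrightarrow>
     (\<forall>u\<in>hop_ball G T v. y u = y' u) \<longrightarrow> F G y v = F G' y' v)"

lemma local_funD:
  assumes "local_fun T F" "simple_graph G" "simple_graph G'" "v \<in> verts G" "agree T v G G'"
    "\<And>u. u \<in> hop_ball G T v \<Longrightarrow> y u = y' u"
  shows "F G y v = F G' y' v"
  by (rule assms(1)[unfolded local_fun_def, rule_format, OF assms(2-5)]) (rule assms(6))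

text \<open>Radii add: \<open>F2\<close> at \<open>v\<close> needs the values of \<open>F1\<close>
  within \<open>T2\<close> of \<open>v\<close>, and each of these needs inputs within
  \<open>T1\<close> of its own node.\<close>

lemma local_fun_comp:
  assumes 1: "local_fun T1 F1" and 2: "local_fun T2 F2" and T: "T1 + T2 \<le> T"
  shows "local_fun T (\<lambda>G y. F2 G (F1 G y))"
  unfolding local_fun_def
proof (intro allI impI)
  fix G G' :: graph and y y' :: "nat \<Rightarrow> 'a" and v
  assume G: "simple_graph G" "simple_graph G'" "v \<in> verts G" "agree T v G G'"
    and y: "\<forall>u\<in>hop_ball G T v. y u = y' u"
  show "F2 G (F1 G y) v = F2 G' (F1 G' y') v"
  proof (rule local_funD[OF 2 G(1-3)])
    show "agree T2 v G G'" using agree_shift[OF G, of v 0 T2] T self_in_hop_ball[OF G(3)] by simp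
    fix u assume u: "u \<in> hop_ball G T2 v"
    show "F1 G y u = F1 G' y' u"
    proof (rule local_funD[OF 1 G(1,2)])
      show "u \<in> verts G" using u by (simp add: hop_ball_near)
      show "agree T1 u G G'" using agree_shift[OF G u] T by simp
      fix w assume "w \<in> hop_ball G T1 u"
      then have "w \<in> hop_ball G (T2 + T1) v"
        using u near_trans[of G T2 v u T1 w] by (simp add: hop_ball_near)
      then have "w \<in> hop_ball G T v" using hop_ball_mono[of "T2 + T1" T G v] T by auto
      then show "y w = y' w" using y by simp
    qed
  qed
qed

lemma local_fun_id: "local_fun T (\<lambda>G y. y)"
  by (simp add: local_fun_def self_in_hop_ball)

lemma local_fun_pair:
  assumes 1: "local_fun T F1" and 2: "local_fun T F2"
  shows "local_fun T (\<lambda>G y v. (F1 G y v, F2 G y v))"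
  unfolding local_fun_def
proof (intro allI impI)
  fix G G' :: graph and y y' :: "nat \<Rightarrow> 'a" and v
  assume G: "simple_graph G" "simple_graph G'" "v \<in> verts G" "agree T v G G'"
    and y: "\<forall>u\<in>hop_ball G T v. y u = y' u"
  show "(F1 G y v, F2 G y v) = (F1 G' y' v, F2 G' y' v)"
    using local_funD[OF 1 G, of y y'] local_funD[OF 2 G, of y y'] y by simp
qed


section \<open>Clusterings without adjacent clusters\<close>

definition red :: "nat \<Rightarrow> nat \<Rightarrow> bool" where "red i c \<longleftrightarrow> \<not> bit c i"

definition proposal ::
  "nat set \<Rightarrow> (nat \<Rightarrow> nat \<Rightarrow> bool) \<Rightarrow> nat \<Rightarrow> (nat \<Rightarrow> nat option) \<Rightarrow> nat \<Rightarrow> nat \<Rightarrow> bool" where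
  "proposal V adj i L v c \<longleftrightarrow> (\<exists>b. L v = Some b \<and> \<not> red i b) \<and>
     red i c \<and> (\<exists>u\<in>V. adj v u \<and> L u = Some c)"

text \<open>The least name makes the choice deterministic and leaves each node with a single
  request, so requests to different clusters come from disjoint sets of nodes. The type is that of a
  labelling, hence \<open>members\<close> applied to it yields the nodes that ask to join a
  cluster.\<close>

definition target ::
  "nat set \<Rightarrow> (nat \<Rightarrow> nat \<Rightarrow> bool) \<Rightarrow> nat \<Rightarrow> (nat \<Rightarrow> nat option) \<Rightarrow> nat \<Rightarrow> nat option" where
  "target V adj i L v =
     (if \<exists>c. proposal V adj i L v c then Some (LEAST c. proposal V adj i L v c) else None)"

definition members :: "nat set \<Rightarrow> (nat \<Rightarrow> nat option) \<Rightarrow> nat \<Rightarrow> nat set" where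
  "members V L c = {v \<in> V. L v = Some c}"

text \<open>Growth by a factor of at least 1 + 1/\<open>m\<close>, without division. Later
  \<open>m\<close> is twice the number of bits.\<close>

definition accepting ::
  "nat set \<Rightarrow> (nat \<Rightarrow> nat \<Rightarrow> bool) \<Rightarrow> nat \<Rightarrow> nat \<Rightarrow> (nat \<Rightarrow> nat option) \<Rightarrow> nat \<Rightarrow> bool" where
  "accepting V adj m i L c \<longleftrightarrow>
     card (members V L c) \<le> m * card (members V (target V adj i L) c)"

text \<open>The label \<open>None\<close> stands for nodes that were discarded or did not take part
  from the beginning.\<close>

definition cluster_step ::
  "nat set \<Rightarrow> (nat \<Rightarrow> nat \<Rightarrow> bool) \<Rightarrow> nat \<Rightarrow> nat \<Rightarrow> (nat \<Rightarrow> nat option) \<Rightarrow> nat \<Rightarrow> nat option" where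
  "cluster_step V adj m i L v = (case target V adj i L v of
       None \<Rightarrow> L v
     | Some c \<Rightarrow> if accepting V adj m i L c then Some c else None)"

lemma target_SomeD:
  assumes "target V adj i L v = Some c" shows "proposal V adj i L v c"
  using assms LeastI_ex[of "proposal V adj i L v"] by (auto simp: target_def split: if_splits)

lemma target_None: "target V adj i L v = None \<longleftrightarrow> (\<forall>c. \<not> proposal V adj i L v c)"
  by (auto simp: target_def)

lemma target_cong:
  assumes "L v = L' v" "\<And>u c. L v \<noteq> None \<Longrightarrow> L' v \<noteq> None \<Longrightarrow> (\<exists>u\<in>V. adj v u \<and> L u = Some c) \<longleftrightarrow> (\<exists>u\<in>V'. adj' v u \<and> L' u = Some c)"
  shows "target V adj i L v = target V' adj' i L' v"
proof -
  have "proposal V adj i L v = proposal V' adj' i L' v"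
    using assms by (auto simp: proposal_def fun_eq_iff)
  then show ?thesis by (simp add: target_def)
qed

lemma cluster_step_cong:
  assumes "\<And>u. u \<in> V \<Longrightarrow> L u = L' u" "\<And>u w. u \<in> V \<Longrightarrow> w \<in> V \<Longrightarrow> adj u w = adj' u w" "v \<in> V"
  shows "cluster_step V adj m i L v = cluster_step V adj' m i L' v"
proof -
  have t: "target V adj i L u = target V adj' i L' u" if "u \<in> V" for u
    by (rule target_cong) (use assms that in auto)
  have "members V L c = members V L' c" for c using assms(1) by (auto simp: members_def)
  moreover have "members V (target V adj i L) c = members V (target V adj' i L') c" for c
    using t by (auto simp: members_def)
  ultimately have "accepting V adj m i L = accepting V adj' m i L'"
    by (simp add: accepting_def fun_eq_iff)
  then show ?thesis using t[OF assms(3)] assms(1)[OF assms(3)] by (simp add: cluster_step_def cong: option.case_cong)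
qed

lemma cluster_step_cases:
  assumes "cluster_step V adj m i L v = Some c"
  obtains "target V adj i L v = None" "L v = Some c"
  | "target V adj i L v = Some c" "accepting V adj m i L c" "red i c"
    "\<And>b. L v = Some b \<Longrightarrow> \<not> red i b" "L v \<noteq> None"
  using assms target_SomeD[of V adj i L v c]
  by (auto simp: cluster_step_def proposal_def split: option.splits if_splits)

lemma cluster_step_dom: "cluster_step V adj m i L v \<noteq> None \<Longrightarrow> L v \<noteq> None"
  by (metis cluster_step_cases option.exhaust)

lemma cluster_step_blue:
  assumes "cluster_step V adj m i L v = Some c" "\<not> red i c"
  shows "L v = Some c" "target V adj i L v = None"
  using assms by (auto elim: cluster_step_cases)

lemma target_None_red:
  assumes "L v = Some c" "red i c" shows "target V adj i L v = None"
  using assms by (auto simp: target_None proposal_def)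

lemma cluster_step_red:
  assumes "L v = Some c" "red i c"
  shows "cluster_step V adj m i L v = Some c"
  using target_None_red[where L = L and v = v, OF assms] assms by (simp add: cluster_step_def)

text \<open>An adjacency of a blue node to a red cluster can only survive a step if the cluster has grown.\<close>

lemma blue_neighbor_accepting:
  assumes sym: "symp adj" and V: "u \<in> V" "v \<in> V"
    and v: "cluster_step V adj m i L v = Some b" "\<not> red i b" and adj: "adj v u"
    and u: "cluster_step V adj m i L u = Some c" "red i c"
  shows "accepting V adj m i L c" "target V adj i L u = Some c"
proof -
  have *: "L v = Some b" "target V adj i L v = None" using cluster_step_blue[OF v] by auto
  then have "\<not> proposal V adj i L v c" by (simp add: target_None)
  then have "L u \<noteq> Some c" using * v u adj V by (auto simp: proposal_def)
  then show "accepting V adj m i L c" "target V adj i L u = Some c"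
    using u(1) by (auto elim: cluster_step_cases)
qed

definition blue_adjacent ::
  "nat set \<Rightarrow> (nat \<Rightarrow> nat \<Rightarrow> bool) \<Rightarrow> nat \<Rightarrow> (nat \<Rightarrow> nat option) \<Rightarrow> nat \<Rightarrow> bool" where
  "blue_adjacent V adj i L c \<longleftrightarrow>
     (\<exists>u\<in>V. \<exists>v\<in>V. \<exists>b. L u = Some c \<and> adj v u \<and> L v = Some b \<and> \<not> red i b)"

text \<open>Discarded nodes will be charged to these nodes: their clusters receive no further
  requests in the current phase.\<close>

definition finished ::
  "nat set \<Rightarrow> (nat \<Rightarrow> nat \<Rightarrow> bool) \<Rightarrow> nat \<Rightarrow> (nat \<Rightarrow> nat option) \<Rightarrow> nat set" where
  "finished V adj i L = {u \<in> V. \<exists>c. L u = Some c \<and> red i c \<and> \<not> blue_adjacent V adj i L c}"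

definition labelled :: "nat set \<Rightarrow> (nat \<Rightarrow> nat option) \<Rightarrow> nat set" where
  "labelled V L = {v \<in> V. L v \<noteq> None}"

lemma members_step_red:
  assumes "red i c"
  shows "members V (cluster_step V adj m i L) c =
    (if accepting V adj m i L c then members V L c \<union> members V (target V adj i L) c else members V L c)"
    (is "?l = ?r")
proof (intro set_eqI iffI)
  fix x assume "x \<in> ?l"
  then have "x \<in> V" "cluster_step V adj m i L x = Some c" by (auto simp: members_def)
  then show "x \<in> ?r" by (auto elim!: cluster_step_cases simp: members_def)
next
  fix x assume "x \<in> ?r"
  then show "x \<in> ?l" using cluster_step_red[of L x c i V adj m] assms
    by (auto simp: members_def cluster_step_def split: if_splits)
qed

lemma members_target_disjoint:
  assumes "red i c" shows "members V L c \<inter> members V (target V adj i L) c = {}"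
proof -
  have "target V adj i L v = None" if "L v = Some c" for v using target_None_red[of L v c i V adj] that assms by simp
  then show ?thesis by (auto simp: members_def)
qed

text \<open>A node that stays blue and labelled has made no request, so it had no neighbor in
  \<open>c\<close> before the step. Its neighbor in \<open>c\<close> must have joined just now:
  hence \<open>c\<close> accepted, and that neighbor was itself a blue neighbor of
  \<open>c\<close>.\<close>

lemma blue_adjacent_step:
  assumes sym: "symp adj" and c: "red i c"
    and b: "blue_adjacent V adj i (cluster_step V adj m i L) c"
  shows "accepting V adj m i L c" "blue_adjacent V adj i L c"
proof -
  obtain u v b where uv: "u \<in> V" "v \<in> V" "adj v u" "cluster_step V adj m i L u = Some c"
    "cluster_step V adj m i L v = Some b" "\<not> red i b"
    using b by (auto simp: blue_adjacent_def)
  note * = blue_neighbor_accepting[OF sym uv(1,2,5,6,3,4) c]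
  show "accepting V adj m i L c" using * by simp
  from target_SomeD[OF *(2)] obtain w b' where "w \<in> V" "adj u w" "L w = Some c" "L u = Some b'" "\<not> red i b'"
    by (auto simp: proposal_def)
  then show "blue_adjacent V adj i L c" using sympD[OF sym] uv(1) unfolding blue_adjacent_def by (meson sympD)
qed

text \<open>Requests come from blue nodes, so they are disjoint from the members of the red cluster,
  and acceptance adds at least a fraction 1/\<open>m\<close>.\<close>

lemma card_members_step:
  assumes V: "finite V" and sym: "symp adj" and c: "red i c"
    and b: "blue_adjacent V adj i (cluster_step V adj m i L) c"
  shows "Suc m * card (members V L c) \<le> m * card (members V (cluster_step V adj m i L) c)"
proof -
  have acc: "accepting V adj m i L c" using blue_adjacent_step[OF sym c b] by simp
  have "card (members V (cluster_step V adj m i L) c) = card (members V L c) + card (members V (target V adj i L) c)"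
    unfolding members_step_red[OF c] using acc V members_target_disjoint[OF c, of V L adj]
    by (simp, intro card_Un_disjoint) (auto simp: members_def)
  then show ?thesis using acc by (simp add: accepting_def algebra_simps)
qed

lemma blue_adjacent_members:
  "blue_adjacent V adj i L c \<Longrightarrow> finite V \<Longrightarrow> card (members V L c) \<ge> 1"
  by (auto simp: blue_adjacent_def members_def Suc_le_eq card_gt_0_iff)

text \<open>A potential argument. A cluster that rejects discards fewer than 1/\<open>m\<close>
  times as many nodes as it has members, and all its members become finished in this very
  step.\<close>

lemma deaths_step:
  fixes m i :: nat and L :: "nat \<Rightarrow> nat option"
  assumes V: "finite V" and sym: "symp adj"
  defines "L' \<equiv> cluster_step V adj m i L"
  shows "m * card (labelled V L) + card (finished V adj i L)
      \<le> m * card (labelled V L') + card (finished V adj i L')"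
proof -
  \<comment> \<open>The red clusters that reject at least one request.\<close>
  define Rj where "Rj = {c. red i c \<and> \<not> accepting V adj m i L c \<and> members V (target V adj i L) c \<noteq> {}}"
  have finm: "finite (members V M c)" for M c using V by (simp add: members_def)
  have dead: "labelled V L - labelled V L' = (\<Union>c\<in>Rj. members V (target V adj i L) c)" (is "?l = ?r")
  proof (intro set_eqI iffI)
    fix x assume "x \<in> ?l"
    then have x: "x \<in> V" "L x \<noteq> None" "L' x = None" by (auto simp: labelled_def)
    then obtain c where c: "target V adj i L x = Some c" "\<not> accepting V adj m i L c"
      by (auto simp: L'_def cluster_step_def split: option.splits if_splits)
    then show "x \<in> ?r" using x target_SomeD[OF c(1)] by (auto simp: Rj_def members_def proposal_def)
  next
    fix x assume "x \<in> ?r"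
    then obtain c where c: "target V adj i L x = Some c" "\<not> accepting V adj m i L c" "x \<in> V"
      by (auto simp: Rj_def members_def)
    then show "x \<in> ?l" using target_SomeD[OF c(1)]
      by (auto simp: labelled_def proposal_def L'_def cluster_step_def)
  qed
  have sub: "labelled V L' \<subseteq> labelled V L" using cluster_step_dom[of V adj m i L] unfolding labelled_def L'_def by fast
  have finL: "finite (labelled V L)" using V by (simp add: labelled_def)
  have finR: "finite Rj"
  proof (rule finite_subset)
    show "Rj \<subseteq> (\<lambda>v. the (target V adj i L v)) ` V"
      by (force simp: Rj_def members_def)
  qed (use V in simp)
  have notadj: "\<not> blue_adjacent V adj i L' c" if "red i c" "\<not> accepting V adj m i L c" for c
    using blue_adjacent_step(1)[OF sym that(1)] that(2) unfolding L'_def by blast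
  have memeq: "members V L' c = members V L c" if "red i c" "\<not> accepting V adj m i L c" for c
    using members_step_red[OF that(1)] that(2) unfolding L'_def by simp
  have Radj: "blue_adjacent V adj i L c" if "c \<in> Rj" for c
  proof -
    from that obtain v where v: "v \<in> V" "target V adj i L v = Some c" by (auto simp: Rj_def members_def)
    from target_SomeD[OF v(2)] v(1) show ?thesis by (auto simp: proposal_def blue_adjacent_def)
  qed
  have fin1: "finished V adj i L \<subseteq> finished V adj i L'"
  proof
    fix u assume "u \<in> finished V adj i L"
    then obtain c where c: "u \<in> V" "L u = Some c" "red i c" "\<not> blue_adjacent V adj i L c"
      by (auto simp: finished_def)
    have "\<not> blue_adjacent V adj i L' c"
      using blue_adjacent_step(2)[OF sym c(3)] c(4) unfolding L'_def by blast
    moreover have "L' u = Some c" unfolding L'_def by (rule cluster_step_red[where L = L and v = u, OF c(2,3)])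
    ultimately show "u \<in> finished V adj i L'" using c by (auto simp: finished_def)
  qed
  \<comment> \<open>Before the step a rejecting cluster has the requesting nodes as blue neighbors;
    afterwards it has none, so its members are newly finished.\<close>
  have fin2: "(\<Union>c\<in>Rj. members V L c) \<subseteq> finished V adj i L' - finished V adj i L"
  proof
    fix u assume "u \<in> (\<Union>c\<in>Rj. members V L c)"
    then obtain c where c: "c \<in> Rj" "u \<in> V" "L u = Some c" by (auto simp: members_def)
    have "L' u = Some c" unfolding L'_def by (rule cluster_step_red[where L = L and v = u, OF c(3)]) (use c in \<open>simp add: Rj_def\<close>)
    then show "u \<in> finished V adj i L' - finished V adj i L"
      using c Radj[OF c(1)] notadj[of c] by (auto simp: finished_def Rj_def)
  qed
  have finF: "finite (finished V adj i L')" using V by (simp add: finished_def)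
  have "m * card (labelled V L - labelled V L') = (\<Sum>c\<in>Rj. m * card (members V (target V adj i L) c))"
    unfolding dead using finR finm by (subst card_UN_disjoint) (auto simp: members_def sum_distrib_left)
  also have "\<dots> \<le> (\<Sum>c\<in>Rj. card (members V L c))"
    by (rule sum_mono) (auto simp: Rj_def accepting_def)
  also have "\<dots> = card (\<Union>c\<in>Rj. members V L c)"
    using finR finm by (subst card_UN_disjoint) (auto simp: members_def)
  also have "\<dots> \<le> card (finished V adj i L' - finished V adj i L)"
    by (rule card_mono) (use fin2 finF in auto)
  also have "\<dots> = card (finished V adj i L') - card (finished V adj i L)"
    using fin1 finF by (simp add: card_Diff_subset finite_subset)
  finally have 1: "m * card (labelled V L - labelled V L') \<le> card (finished V adj i L') - card (finished V adj i L)" .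
  have 2: "card (labelled V L - labelled V L') = card (labelled V L) - card (labelled V L')"
    using sub finL by (simp add: card_Diff_subset finite_subset)
  have 3: "card (labelled V L') \<le> card (labelled V L)" using sub finL by (rule card_mono[rotated])
  have 4: "card (finished V adj i L) \<le> card (finished V adj i L')" using fin1 finF by (rule card_mono[rotated])
  have "m * card (labelled V L) = m * card (labelled V L - labelled V L') + m * card (labelled V L')"
    using 2 3 by (simp add: diff_mult_distrib2)
  then show ?thesis using 1 4 by simp
qed


section \<open>Phases of \<open>R\<close> steps, one phase for each bit\<close>

primrec cluster_seq ::
  "nat set \<Rightarrow> (nat \<Rightarrow> nat \<Rightarrow> bool) \<Rightarrow> nat \<Rightarrow> nat \<Rightarrow> (nat \<Rightarrow> nat option) \<Rightarrow> nat \<Rightarrow> nat \<Rightarrow> nat option" where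
  "cluster_seq V adj m R L 0 = L"
| "cluster_seq V adj m R L (Suc j) = cluster_step V adj m (j div R) (cluster_seq V adj m R L j)"

lemma cluster_step_neighbor:
  assumes "cluster_step V adj m i L v = Some c"
  shows "L v = Some c \<or> (\<exists>u\<in>V. adj v u \<and> L u = Some c)"
  using assms by (auto elim!: cluster_step_cases dest!: target_SomeD simp: proposal_def)

lemma labelled_seq_mono: "labelled V (cluster_seq V adj m R L j) \<subseteq> labelled V L"
proof (induction j)
  case (Suc j)
  then show ?case using cluster_step_dom[of V adj m "j div R" "cluster_seq V adj m R L j"]
    unfolding labelled_def by (simp, blast)
qed simp

definition low_bits_agree ::
  "nat set \<Rightarrow> (nat \<Rightarrow> nat \<Rightarrow> bool) \<Rightarrow> nat \<Rightarrow> (nat \<Rightarrow> nat option) \<Rightarrow> bool" where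
  "low_bits_agree V adj i L \<longleftrightarrow> (\<forall>u\<in>V. \<forall>v\<in>V. \<forall>a b. adj u v \<longrightarrow> L u = Some a \<longrightarrow> L v = Some b \<longrightarrow>
     (\<forall>j<i. bit a j \<longleftrightarrow> bit b j))"

text \<open>A label can only be replaced by the label of a neighbor, which has the same low bits.
  Hence every node that survives keeps its low bits.\<close>

lemma low_bits_agree_step:
  assumes inv: "low_bits_agree V adj i L"
  shows "low_bits_agree V adj i (cluster_step V adj m i' L)"
proof -
  have pres: "bit a j \<longleftrightarrow> bit a' j"
    if u: "u \<in> V" "L u = Some a" "cluster_step V adj m i' L u = Some a'" "j < i" for u a a' j
    using cluster_step_neighbor[OF u(3)] inv u unfolding low_bits_agree_def by (metis option.inject)
  show ?thesis unfolding low_bits_agree_def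
  proof (intro ballI allI impI)
    fix u v a' b' j
    assume *: "u \<in> V" "v \<in> V" "adj u v" "cluster_step V adj m i' L u = Some a'"
      "cluster_step V adj m i' L v = Some b'" "j < i"
    obtain a b where ab: "L u = Some a" "L v = Some b"
      using cluster_step_dom[of V adj m i' L u] cluster_step_dom[of V adj m i' L v] * by auto
    have "bit a j \<longleftrightarrow> bit b j" using inv ab * unfolding low_bits_agree_def by blast
    then show "bit a' j \<longleftrightarrow> bit b' j" using pres[OF *(1) ab(1) *(4,6)] pres[OF *(2) ab(2) *(5,6)] by simp
  qed
qed

text \<open>The last assumption says that \<open>R\<close> growths by the factor 1 +
  1/\<open>m\<close> lead beyond the number of nodes.\<close>

context
  fixes V :: "nat set" and adj :: "nat \<Rightarrow> nat \<Rightarrow> bool" and m R :: nat and L :: "nat \<Rightarrow> nat option"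
  assumes V: "finite V" and sym: "symp adj"
    and R: "m ^ R * card V < Suc m ^ R"
begin

lemma phase_step:
  assumes "s < R"
  shows "cluster_seq V adj m R L (i * R + Suc s) = cluster_step V adj m i (cluster_seq V adj m R L (i * R + s))"
  using assms by (simp add: div_add1_eq)

text \<open>By \<open>blue_adjacent_step\<close> a cluster with a blue neighbor now had one after
  every earlier step of the phase, so it accepted and grew each time.\<close>

lemma phase_growth:
  assumes "red i c" "s \<le> R" "blue_adjacent V adj i (cluster_seq V adj m R L (i * R + s)) c"
  shows "Suc m ^ s \<le> m ^ s * card (members V (cluster_seq V adj m R L (i * R + s)) c)"
  using assms(2,3)
proof (induction s)
  case 0
  then show ?case using blue_adjacent_members[OF _ V] by simp
next
  case (Suc s)
  let ?L = "cluster_seq V adj m R L (i * R + s)"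
  have eq: "cluster_seq V adj m R L (i * R + Suc s) = cluster_step V adj m i ?L"
    by (rule phase_step) (use Suc.prems in simp)
  note b = Suc.prems(2)[unfolded eq]
  have "blue_adjacent V adj i ?L c" using blue_adjacent_step(2)[OF sym assms(1) b] .
  then have "Suc m ^ s \<le> m ^ s * card (members V ?L c)" using Suc.IH Suc.prems(1) by simp
  then have "Suc m * Suc m ^ s \<le> Suc m * (m ^ s * card (members V ?L c))"
    by (rule mult_le_mono2)
  then have "Suc m ^ Suc s \<le> m ^ s * (Suc m * card (members V ?L c))"
    by (simp only: power_Suc ac_simps)
  also have "\<dots> \<le> m ^ s * (m * card (members V (cluster_step V adj m i ?L) c))"
    by (rule mult_le_mono2[OF card_members_step[OF V sym assms(1) b]])
  finally show ?case unfolding eq by (simp add: ac_simps)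
qed

lemma phase_end:
  assumes "red i c" shows "\<not> blue_adjacent V adj i (cluster_seq V adj m R L (Suc i * R)) c"
proof
  assume "blue_adjacent V adj i (cluster_seq V adj m R L (Suc i * R)) c"
  then have "Suc m ^ R \<le> m ^ R * card (members V (cluster_seq V adj m R L (Suc i * R)) c)"
    using phase_growth[OF assms, of R] by (simp add: add.commute)
  also have "\<dots> \<le> m ^ R * card V" using V by (intro mult_le_mono2 card_mono) (auto simp: members_def)
  finally show False using R by simp
qed

lemma phase_deaths:
  assumes "s \<le> R"
  shows "m * card (labelled V (cluster_seq V adj m R L (i * R))) \<le>
    m * card (labelled V (cluster_seq V adj m R L (i * R + s))) +
    card (finished V adj i (cluster_seq V adj m R L (i * R + s)))"
  using assms
proof (induction s)
  case (Suc s)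
  then show ?case
    using deaths_step[OF V sym, of m "cluster_seq V adj m R L (i * R + s)" i] phase_step[of s i] by simp
qed simp

text \<open>The finished nodes at the end of a phase are among the nodes labelled initially, so by
  \<open>phase_deaths\<close> each phase discards at most a fraction 1/\<open>m\<close> of the
  latter.\<close>

lemma total_deaths:
  "m * card (labelled V L) \<le> m * card (labelled V (cluster_seq V adj m R L (i * R))) + i * card (labelled V L)"
proof (induction i)
  case (Suc i)
  let ?L = "cluster_seq V adj m R L (Suc i * R)"
  have "finished V adj i ?L \<subseteq> labelled V ?L" by (auto simp: finished_def labelled_def)
  also have "\<dots> \<subseteq> labelled V L" by (rule labelled_seq_mono)
  finally have "card (finished V adj i ?L) \<le> card (labelled V L)"
    using V by (intro card_mono) (auto simp: labelled_def)
  then show ?case using Suc phase_deaths[of R i] by (simp add: add.commute)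
qed simp

lemma low_bits_agree_phase:
  assumes "low_bits_agree V adj i (cluster_seq V adj m R L (i * R))" "s \<le> R"
  shows "low_bits_agree V adj i (cluster_seq V adj m R L (i * R + s))"
  using assms(2)
proof (induction s)
  case (Suc s)
  then show ?case using low_bits_agree_step[of V adj i] phase_step[of s i] by simp
qed (use assms(1) in simp)

lemma low_bits_agree_seq: "low_bits_agree V adj i (cluster_seq V adj m R L (i * R))"
proof (induction i)
  case (Suc i)
  let ?L = "cluster_seq V adj m R L (Suc i * R)"
  have low: "low_bits_agree V adj i ?L" using low_bits_agree_phase[OF Suc, of R] by (simp add: add.commute)
  have "bit a i \<longleftrightarrow> bit b i" if uv: "u \<in> V" "v \<in> V" "adj u v" "?L u = Some a" "?L v = Some b" for u v a b
  proof -
    \<comment> \<open>Neither of two adjacent nodes can be red with the other one blue, by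
      \<open>phase_end\<close> in both directions; so they agree on bit \<open>i\<close> as
      well.\<close>
    have "\<not> (red i x \<and> \<not> red i y)" if "p \<in> V" "q \<in> V" "adj q p" "?L p = Some x" "?L q = Some y" for p q x y
      using phase_end[of i x] that unfolding blue_adjacent_def by blast
    from this[of u v a b] this[of v u b a] uv sympD[OF sym uv(3)] show ?thesis by (auto simp: red_def)
  qed
  with low show ?case unfolding low_bits_agree_def less_Suc_eq by blast
qed (simp add: low_bits_agree_def)

lemma seq_label_origin: "v \<in> V \<Longrightarrow> cluster_seq V adj m R L j v = Some c \<Longrightarrow> \<exists>u\<in>V. L u = Some c"
proof (induction j arbitrary: v)
  case (Suc j)
  then show ?case using cluster_step_neighbor[of V adj m "j div R" "cluster_seq V adj m R L j" v c]
    by (metis cluster_seq.simps(2))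
qed auto

text \<open>Names have only \<open>b\<close> bits, and after \<open>b\<close> phases adjacent nodes
  agree on all of them.\<close>

lemma cluster_seq_separated:
  assumes lt: "\<And>v c. v \<in> V \<Longrightarrow> L v = Some c \<Longrightarrow> c < 2 ^ b"
    and u: "u \<in> V" "cluster_seq V adj m R L (b * R) u = Some x"
    and v: "v \<in> V" "cluster_seq V adj m R L (b * R) v = Some y" and "adj u v"
  shows "x = y"
proof -
  have "x < 2 ^ b" "y < 2 ^ b" using seq_label_origin u v lt by blast+
  then have "take_bit b x = x" "take_bit b y = y" by (simp_all add: take_bit_nat_eq_self)
  moreover have bits: "bit x j \<longleftrightarrow> bit y j" if "j < b" for j
    using low_bits_agree_seq[of b, unfolded low_bits_agree_def, rule_format, OF u(1) v(1) \<open>adj u v\<close> u(2) v(2) that] .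
  have "take_bit b x = take_bit b y"
  proof (rule bit_eqI)
    fix n show "bit (take_bit b x) n \<longleftrightarrow> bit (take_bit b y) n"
      unfolding bit_take_bit_iff using bits[of n] by fast
  qed
  ultimately show ?thesis by metis
qed

text \<open>There are \<open>b\<close> phases, each discarding at most a fraction
  1/(2\<open>b\<close>).\<close>

lemma cluster_seq_half:
  assumes "m = 2 * b" "b > 0"
  shows "card (labelled V L) \<le> 2 * card (labelled V (cluster_seq V adj m R L (b * R)))"
proof -
  have "b * (2 * card (labelled V L)) \<le> b * (2 * card (labelled V (cluster_seq V adj m R L (b * R))) + card (labelled V L))"
    using total_deaths[of b] assms(1) by (simp add: algebra_simps)
  then show ?thesis using assms(2) by simp
qed

end


section \<open>Network decompositions\<close>

text \<open>The step at \<open>v\<close> depends on one cluster next to \<open>v\<close>. Its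
  members are within 2\<open>\<rho>\<close> + \<open>k\<close> of \<open>v\<close>, since all are
  within \<open>\<rho>\<close> of the node that names it; the nodes asking to join it are within
  2\<open>\<rho>\<close> + 2\<open>k\<close>, and their neighbors, which determine whom they ask,
  within 2\<open>\<rho>\<close> + 3\<open>k\<close>.\<close>

lemma cluster_step_truncate:
  assumes rad: "\<And>u c. u \<in> verts G \<Longrightarrow> L u = Some c \<Longrightarrow> near G \<rho> u c"
    and M: "2 * \<rho> + 3 * k \<le> M" and v: "v \<in> verts G"
  shows "cluster_step (verts G) (near G k) m i L v = cluster_step (hop_ball G M v) (near G k) m i L v"
proof -
  let ?V = "verts G" let ?B = "hop_ball G M v"
  have BV: "?B \<subseteq> ?V" by (auto simp: hop_ball_near)
  have tgt: "target ?V (near G k) i L u = target ?B (near G k) i L u" if u: "near G (2 * \<rho> + 2 * k) v u" for u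
  proof (rule target_cong)
    fix w c
    have "x \<in> ?B" if "x \<in> ?V" "near G k u x" for x
      using that near_trans[OF u that(2)] M by (auto simp: hop_ball_near intro: near_mono)
    then show "(\<exists>w\<in>?V. near G k u w \<and> L w = Some c) \<longleftrightarrow> (\<exists>w\<in>?B. near G k u w \<and> L w = Some c)"
      using BV by blast
  qed simp
  have tv: "target ?V (near G k) i L v = target ?B (near G k) i L v" by (rule tgt) simp
  have acc: "accepting ?V (near G k) m i L c = accepting ?B (near G k) m i L c"
    if t: "target ?V (near G k) i L v = Some c" for c
  proof -
    from target_SomeD[OF t] obtain u where u: "u \<in> ?V" "near G k v u" "L u = Some c"
      by (auto simp: proposal_def)
    have vc: "near G (k + \<rho>) v c" using near_trans[OF u(2) rad[OF u(1,3)]] .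
    have mem: "near G (k + \<rho> + \<rho>) v x" if "x \<in> ?V" "L x = Some c" for x
      using near_trans[OF vc near_sym[OF rad[OF that]]] .
    have "x \<in> ?B" if "x \<in> ?V" "L x = Some c" for x
      using mem[OF that] that(1) M by (auto simp: hop_ball_near intro: near_mono)
    then have 1: "members ?V L c = members ?B L c" using BV by (auto simp: members_def)
    have cand: "near G (2 * \<rho> + 2 * k) v x" if "W \<subseteq> ?V" "target W (near G k) i L x = Some c" for x W
    proof -
      from target_SomeD[OF that(2)] that(1) obtain w where "w \<in> ?V" "near G k x w" "L w = Some c"
        by (auto simp: proposal_def)
      from near_trans[OF mem[OF this(1,3)] near_sym[OF this(2)]] show ?thesis
        by (rule near_mono) simp
    qed
    have "members ?V (target ?V (near G k) i L) c = members ?B (target ?B (near G k) i L) c"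
    proof (intro set_eqI iffI)
      fix x assume "x \<in> members ?V (target ?V (near G k) i L) c"
      then have x: "x \<in> ?V" "target ?V (near G k) i L x = Some c" by (auto simp: members_def)
      have near: "near G (2 * \<rho> + 2 * k) v x" using cand[OF _ x(2)] by simp
      have "near G M v x" by (rule near_mono[OF near]) (use M in simp)
      then show "x \<in> members ?B (target ?B (near G k) i L) c"
        using tgt[OF near] x by (simp add: members_def hop_ball_near)
    next
      fix x assume "x \<in> members ?B (target ?B (near G k) i L) c"
      then have x: "x \<in> ?B" "target ?B (near G k) i L x = Some c" by (auto simp: members_def)
      show "x \<in> members ?V (target ?V (near G k) i L) c"
        using tgt[OF cand[OF BV x(2)]] x BV by (auto simp: members_def)
    qed
    with 1 show ?thesis by (simp add: accepting_def)
  qed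
  show ?thesis unfolding cluster_step_def
    using tv acc by (auto split: option.splits)
qed

text \<open>A variant of \<open>cluster_seq\<close> that is local by construction, as each node
  evaluates a step on its own ball. \<open>truncated_seq_eq\<close> shows that the result is the
  same.\<close>

primrec truncated_seq ::
  "nat \<Rightarrow> nat \<Rightarrow> nat \<Rightarrow> nat \<Rightarrow> nat \<Rightarrow> graph \<Rightarrow> (nat \<Rightarrow> nat option) \<Rightarrow> nat \<Rightarrow> nat option" where
  "truncated_seq k M m R 0 G L = L"
| "truncated_seq k M m R (Suc j) G L =
     (\<lambda>v. cluster_step (hop_ball G M v) (near G k) m (j div R) (truncated_seq k M m R j G L) v)"

text \<open>The summand \<open>k\<close> is due to walks between nodes of the \<open>M\<close>-ball,
  which may leave this ball.\<close>

lemma local_truncated_step: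
  "local_fun (M + k) (\<lambda>G L v. cluster_step (hop_ball G M v) (near G k) m i L v)"
  unfolding local_fun_def
proof (intro allI impI)
  fix G G' :: graph and L L' :: "nat \<Rightarrow> nat option" and v
  assume G: "simple_graph G" "simple_graph G'" "v \<in> verts G" "agree (M + k) v G G'"
    and L: "\<forall>u\<in>hop_ball G (M + k) v. L u = L' u"
  have b: "hop_ball G M v = hop_ball G' M v"
    by (rule agree_hop_ball[OF G near_refl[of G 0]]) simp
  show "cluster_step (hop_ball G M v) (near G k) m i L v = cluster_step (hop_ball G' M v) (near G' k) m i L' v"
    unfolding b[symmetric]
  proof (rule cluster_step_cong)
    show "v \<in> hop_ball G M v" using G(3) by (rule self_in_hop_ball)
    fix u assume u: "u \<in> hop_ball G M v"
    then show "L u = L' u" using L hop_ball_mono[of M "M + k" G v] by auto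
    fix w
    show "near G k u w = near G' k u w"
      by (rule agree_near[OF G, of M]) (use u in \<open>simp_all add: hop_ball_near\<close>)
  qed
qed

lemma local_truncated_seq: "local_fun (j * (M + k)) (truncated_seq k M m R j)"
proof (induction j)
  case 0
  then show ?case using local_fun_id by simp
next
  case (Suc j)
  show ?case using local_fun_comp[OF Suc local_truncated_step[of M k m "j div R"] order_refl]
    by (simp add: add.commute)
qed

text \<open>Initially a cluster is a single node and bears its name. A step moves a label by at most
  \<open>k\<close>, so after \<open>j\<close> steps a node is within \<open>j * k\<close> of the
  node that names its cluster; \<open>M\<close> is large enough for all \<open>J\<close>
  steps.\<close>

lemma truncated_seq_eq:
  assumes L: "\<And>v c. L v = Some c \<Longrightarrow> c = v" and M: "2 * (J * k) + 3 * k \<le> M"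
  shows "j \<le> J \<Longrightarrow> v \<in> verts G \<Longrightarrow> truncated_seq k M m R j G L v = cluster_seq (verts G) (near G k) m R L j v \<and>
    (\<forall>c. cluster_seq (verts G) (near G k) m R L j v = Some c \<longrightarrow> near G (j * k) v c)"
proof (induction j arbitrary: v)
  case 0
  then show ?case using L by auto
next
  case (Suc j)
  let ?L = "cluster_seq (verts G) (near G k) m R L j"
  have IH: "truncated_seq k M m R j G L u = ?L u" "\<And>c. ?L u = Some c \<Longrightarrow> near G (j * k) u c"
    if "u \<in> verts G" for u using Suc.IH[of u] that Suc.prems(1) by auto
  have jk: "j * k \<le> J * k" using Suc.prems(1) by (intro mult_le_mono1) simp
  have "truncated_seq k M m R (Suc j) G L v = cluster_step (hop_ball G M v) (near G k) m (j div R) ?L v"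
    unfolding truncated_seq.simps
    by (rule cluster_step_cong) (use IH(1) Suc.prems in \<open>auto simp: hop_ball_near\<close>)
  also have "\<dots> = cluster_step (verts G) (near G k) m (j div R) ?L v"
    by (rule cluster_step_truncate[symmetric, OF IH(2) _ Suc.prems(2)]) (use M jk in linarith)+
  finally have 1: "truncated_seq k M m R (Suc j) G L v = cluster_seq (verts G) (near G k) m R L (Suc j) v"
    by simp
  have "near G (Suc j * k) v c" if "cluster_step (verts G) (near G k) m (j div R) ?L v = Some c" for c
    using cluster_step_neighbor[OF that]
  proof
    assume "?L v = Some c"
    from IH(2)[OF Suc.prems(2) this] show ?thesis by (rule near_mono) simp
  next
    assume "\<exists>u\<in>verts G. near G k v u \<and> ?L u = Some c"
    then obtain u where u: "u \<in> verts G" "near G k v u" "?L u = Some c" by blast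
    show ?thesis using near_trans[OF u(2) IH(2)[OF u(1,3)]] by simp
  qed
  with 1 show ?case by simp
qed

text \<open>The value at a node is its colour together with the name of its cluster.\<close>

definition colour_round ::
  "nat \<Rightarrow> nat \<Rightarrow> nat \<Rightarrow> nat \<Rightarrow> nat \<Rightarrow> nat \<Rightarrow> graph \<Rightarrow> (nat \<Rightarrow> (nat \<times> nat) option) \<Rightarrow> nat \<Rightarrow> (nat \<times> nat) option" where
  "colour_round k M m R J j G y v = (case y v of
       Some p \<Rightarrow> Some p
     | None \<Rightarrow> map_option (Pair j) (truncated_seq k M m R J G (\<lambda>u. if y u = None then Some u else None) v))"

primrec decomposition ::
  "nat \<Rightarrow> nat \<Rightarrow> nat \<Rightarrow> nat \<Rightarrow> nat \<Rightarrow> nat \<Rightarrow> graph \<Rightarrow> (nat \<Rightarrow> 'a) \<Rightarrow> nat \<Rightarrow> (nat \<times> nat) option" where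
  "decomposition k M m R J 0 G x = (\<lambda>v. None)"
| "decomposition k M m R J (Suc j) G x = colour_round k M m R J j G (decomposition k M m R J j G x)"

lemma local_colour_round: "local_fun (J * (M + k)) (colour_round k M m R J j)"
  unfolding local_fun_def
proof (intro allI impI)
  fix G G' :: graph and y y' :: "nat \<Rightarrow> (nat \<times> nat) option" and v
  assume G: "simple_graph G" "simple_graph G'" "v \<in> verts G" "agree (J * (M + k)) v G G'"
    and y: "\<forall>u\<in>hop_ball G (J * (M + k)) v. y u = y' u"
  have "y v = y' v" using y self_in_hop_ball[OF G(3)] by blast
  moreover have "truncated_seq k M m R J G (\<lambda>u. if y u = None then Some u else None) v =
      truncated_seq k M m R J G' (\<lambda>u. if y' u = None then Some u else None) v"
    by (rule local_funD[OF local_truncated_seq G]) (use y in simp)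
  ultimately show "colour_round k M m R J j G y v = colour_round k M m R J j G' y' v"
    by (simp add: colour_round_def cong: option.case_cong)
qed

lemma local_decomposition: "local_fun (j * (J * (M + k))) (decomposition k M m R J j)"
proof (induction j)
  case 0
  then show ?case by (simp add: local_fun_def)
next
  case (Suc j)
  show ?case using local_fun_comp[OF Suc local_colour_round[of J M k m R j] order_refl]
    by (simp add: add.commute)
qed

section \<open>Correctness of the network decomposition\<close>

context
  fixes G :: graph and k M m R b :: nat
  assumes G: "simple_graph G" and R: "m ^ R * card (verts G) < Suc m ^ R"
    and m: "m = 2 * b" "b > 0" and names: "verts G \<subseteq> {..<2 ^ b}"
    and M: "2 * (b * R * k) + 3 * k \<le> M"
begin

abbreviation "dec \<equiv> decomposition k M m R (b * R)"

definition "start x j = (\<lambda>v. if dec j G x v = None then Some v else None)"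

definition "clustering x j = cluster_seq (verts G) (near G k) m R (start x j) (b * R)"

lemma finite_verts: "finite (verts G)" using G by (simp add: simple_graph_def)

lemma symp_near: "symp (near G k)" by (rule sympI) (rule near_sym)

lemma decomposition_Suc:
  assumes "v \<in> verts G"
  shows "dec (Suc j) G x v = (case dec j G x v of
       Some p \<Rightarrow> Some p | None \<Rightarrow> map_option (Pair j) (clustering x j v))"
proof -
  have "truncated_seq k M m R (b * R) G (start x j) v = clustering x j v"
    unfolding clustering_def
    by (rule truncated_seq_eq[where J = "b * R", THEN conjunct1])
       (use M assms in \<open>auto simp: start_def split: if_splits\<close>)
  then show ?thesis by (simp add: colour_round_def start_def cong: option.case_cong)
qed

declare decomposition.simps(2) [simp del]

lemma clustering_near:
  assumes "v \<in> verts G" "clustering x j v = Some c" shows "near G (b * R * k) v c"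
  by (rule truncated_seq_eq[where J = "b * R" and j = "b * R" and L = "start x j" and M = M,
        THEN conjunct2, rule_format])
     (use M assms in \<open>auto simp: start_def clustering_def split: if_splits\<close>)

lemma clustering_uncoloured:
  assumes "v \<in> verts G" "clustering x j v \<noteq> None" shows "dec j G x v = None"
proof -
  have "v \<in> labelled (verts G) (start x j)"
    using assms labelled_seq_mono[of "verts G" "near G k" m R "start x j" "b * R"]
    unfolding clustering_def labelled_def by blast
  then show ?thesis by (simp add: labelled_def start_def split: if_splits)
qed

lemma decomposition_near:
  assumes "v \<in> verts G" "dec j G x v = Some (i, c)"
  shows "i < j \<and> near G (b * R * k) v c"
  using assms(2)
proof (induction j)
  case (Suc j)
  then show ?case using clustering_near[OF assms(1), of x j] assms(1)
    by (auto simp: decomposition_Suc split: option.splits)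
qed simp

text \<open>Nodes of the same colour received it in the same round, hence from a single clustering,
  to which \<open>cluster_seq_separated\<close> applies.\<close>

lemma decomposition_separated:
  assumes uv: "u \<in> verts G" "v \<in> verts G" "near G k u v"
    and "dec j G x u = Some (i, a)" "dec j G x v = Some (i, b')"
  shows "a = b'"
  using assms(4,5)
proof (induction j)
  case (Suc j)
  show ?case
  proof (cases "dec j G x u")
    case None
    then have u: "i = j" "clustering x j u = Some a" using Suc.prems uv by (auto simp: decomposition_Suc)
    then have "dec j G x v = None"
      using decomposition_near[OF uv(2), of j x i b'] Suc.prems uv
      by (auto simp: decomposition_Suc split: option.splits)
    then have v: "clustering x j v = Some b'" using Suc.prems uv by (auto simp: decomposition_Suc)
    show ?thesis
    proof (rule cluster_seq_separated[OF finite_verts symp_near R _ uv(1) _ uv(2) _ uv(3)])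
      show "c < 2 ^ b" if "w \<in> verts G" "start x j w = Some c" for w c
        using names that by (auto simp: start_def split: if_splits)
    qed (use u v in \<open>simp_all add: clustering_def\<close>)
  next
    case (Some p)
    then have p: "dec j G x u = Some (i, a)" using Suc.prems uv by (auto simp: decomposition_Suc)
    have "i < j" using decomposition_near[OF uv(1) p] by simp
    then have "dec j G x v = Some (i, b')"
      using Suc.prems uv by (auto simp: decomposition_Suc split: option.splits)
    with p Suc.IH show ?thesis by simp
  qed
qed simp

text \<open>Each round colours at least half of the nodes that are still uncoloured.\<close>

lemma uncoloured_bound: "2 ^ j * card {v \<in> verts G. dec j G x v = None} \<le> card (verts G)"
proof (induction j)
  case (Suc j)
  let ?U = "\<lambda>j. {v \<in> verts G. dec j G x v = None}"
  let ?C = "labelled (verts G) (clustering x j)"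
  have U: "labelled (verts G) (start x j) = ?U j" unfolding labelled_def start_def by (rule Collect_cong) simp
  have "?U (Suc j) = ?U j - ?C"
    by (auto simp: decomposition_Suc labelled_def split: option.splits)
  moreover have "?C \<subseteq> ?U j" using clustering_uncoloured by (auto simp: labelled_def)
  ultimately have "card (?U (Suc j)) = card (?U j) - card ?C"
    using finite_verts by (simp add: card_Diff_subset finite_subset)
  moreover have "card (?U j) \<le> 2 * card ?C"
    using cluster_seq_half[OF finite_verts symp_near R m, of "start x j"] U by (simp add: clustering_def)
  ultimately have "2 * card (?U (Suc j)) \<le> card (?U j)" by simp
  then have "2 ^ j * (2 * card (?U (Suc j))) \<le> 2 ^ j * card (?U j)" by (rule mult_le_mono2)
  also have "\<dots> \<le> card (verts G)" by (rule Suc.IH)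
  finally show ?case by simp
qed simp

lemma decomposition_total:
  assumes "card (verts G) < 2 ^ j" "v \<in> verts G"
  shows "dec j G x v \<noteq> None"
proof
  assume "dec j G x v = None"
  then have "card {v \<in> verts G. dec j G x v = None} \<noteq> 0" using finite_verts assms(2) by auto
  then have "2 ^ j * 1 \<le> 2 ^ j * card {v \<in> verts G. dec j G x v = None}" by (intro mult_le_mono2) simp
  then show False using uncoloured_bound[of j x] assms(1) by linarith
qed

end

text \<open>By Bernoulli's inequality \<open>m\<close> growths by the factor 1 + 1/\<open>m\<close>
  amount to a doubling, and \<open>Suc l\<close> doublings exceed \<open>n\<close>. This fixes the
  number \<open>R\<close> of steps per bit.\<close>

lemma growth_exceeds:
  assumes "m > 0" "n < 2 ^ Suc l"
  shows "m ^ (m * Suc l) * n < Suc m ^ (m * Suc l)"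
proof -
  have "- 1 \<le> 1 / real m" by (rule order_trans[of _ 0]) simp_all
  then have "(2::real) \<le> (1 + 1 / real m) ^ m"
    using Bernoulli_inequality[of "1 / real m" m] assms(1) by simp
  then have "2 * real m ^ m \<le> (1 + 1 / real m) ^ m * real m ^ m" by (rule mult_right_mono) simp
  also have "\<dots> = ((1 + 1 / real m) * real m) ^ m" by (rule power_mult_distrib[symmetric])
  also have "(1 + 1 / real m) * real m = real (Suc m)" using assms(1) by (simp add: field_simps)
  finally have "real (2 * m ^ m) \<le> real (Suc m ^ m)" by simp
  then have "2 * m ^ m \<le> Suc m ^ m" by (simp only: of_nat_le_iff)
  then have "(2 * m ^ m) ^ Suc l \<le> (Suc m ^ m) ^ Suc l" by (rule power_mono) simp
  then have "m ^ (m * Suc l) * 2 ^ Suc l \<le> Suc m ^ (m * Suc l)"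
    by (simp only: power_mult_distrib power_mult mult.commute)
  moreover have "m ^ (m * Suc l) * n < m ^ (m * Suc l) * 2 ^ Suc l" using assms by simp
  ultimately show ?thesis by linarith
qed


section \<open>Naming vertices by their identifiers\<close>

text \<open>The graph as the nodes perceive it. Algorithms are analysed on it with the identity as
  identifiers, and the results are carried back to the original graph.\<close>

definition relabel :: "labelling \<Rightarrow> graph \<Rightarrow> graph" where
  "relabel ident G = \<lparr>verts = ident ` verts G, edges = (`) ident ` edges G\<rparr>"

definition transported :: "graph \<Rightarrow> labelling \<Rightarrow> (nat \<Rightarrow> 'a) \<Rightarrow> nat \<Rightarrow> 'a" where
  "transported G ident y w = y (inv_into (verts G) ident w)"

lemma relabel_sel [simp]:
  "verts (relabel ident G) = ident ` verts G" "edges (relabel ident G) = (`) ident ` edges G"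
  by (simp_all add: relabel_def)

lemma edge_verts: "simple_graph G \<Longrightarrow> {a, b} \<in> edges G \<Longrightarrow> a \<in> verts G \<and> b \<in> verts G"
  by (auto simp: simple_graph_def)

context
  fixes G :: graph and ident :: labelling
  assumes G: "simple_graph G" and inj: "inj_on ident (verts G)"
begin

lemma transported_ident [simp]: "v \<in> verts G \<Longrightarrow> transported G ident y (ident v) = y v"
  using inj by (simp add: transported_def)

lemma card_relabel: "card (verts (relabel ident G)) = card (verts G)"
  using inj by (simp add: card_image)

lemma simple_relabel: "simple_graph (relabel ident G)"
  unfolding simple_graph_def
proof (intro conjI ballI)
  show "finite (verts (relabel ident G))" using G by (simp add: simple_graph_def)
  fix e assume "e \<in> edges (relabel ident G)"
  then obtain f where f: "e = ident ` f" "f \<in> edges G" by auto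
  then have *: "f \<subseteq> verts G" "card f = 2" using G by (auto simp: simple_graph_def)
  then show "e \<subseteq> verts (relabel ident G)" using f by auto
  show "card e = 2" using * f inj by (metis card_image inj_on_subset)
qed

lemma relabel_edge:
  assumes "a \<in> verts G" "b \<in> verts G"
  shows "{ident a, ident b} \<in> edges (relabel ident G) \<longleftrightarrow> {a, b} \<in> edges G"
proof
  assume "{ident a, ident b} \<in> edges (relabel ident G)"
  then obtain f where f: "ident ` {a, b} = ident ` f" "f \<in> edges G" by auto
  have "f \<subseteq> verts G" using f(2) G by (auto simp: simple_graph_def)
  then have "{a, b} = f" using f(1) inj assms by (subst (asm) inj_on_image_eq_iff) auto
  then show "{a, b} \<in> edges G" using f(2) by simp
next
  assume "{a, b} \<in> edges G"
  then have "ident ` {a, b} \<in> edges (relabel ident G)" by (simp only: relabel_sel) (rule imageI)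
  then show "{ident a, ident b} \<in> edges (relabel ident G)" by simp
qed

lemma relabel_near:
  assumes "u \<in> verts G" "v \<in> verts G"
  shows "near (relabel ident G) k (ident u) (ident v) \<longleftrightarrow> near G k u v"
  using assms(2)
proof (induction k arbitrary: v)
  case 0
  then show ?case using inj assms(1) by (auto simp: inj_on_eq_iff)
next
  case (Suc k)
  have "(\<exists>w. near (relabel ident G) k (ident u) w \<and> {w, ident v} \<in> edges (relabel ident G)) \<longleftrightarrow>
      (\<exists>w. near G k u w \<and> {w, v} \<in> edges G)"
  proof
    assume "\<exists>w. near (relabel ident G) k (ident u) w \<and> {w, ident v} \<in> edges (relabel ident G)"
    then obtain w where w: "near (relabel ident G) k (ident u) w" "{w, ident v} \<in> edges (relabel ident G)" by blast
    obtain z where z: "z \<in> verts G" "w = ident z" using edge_verts[OF simple_relabel w(2)] by auto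
    then show "\<exists>w. near G k u w \<and> {w, v} \<in> edges G"
      using w Suc.IH[OF z(1)] relabel_edge[OF z(1) Suc.prems] by blast
  next
    assume "\<exists>w. near G k u w \<and> {w, v} \<in> edges G"
    then obtain w where w: "near G k u w" "{w, v} \<in> edges G" by blast
    have "w \<in> verts G" using edge_verts[OF G w(2)] by simp
    then show "\<exists>w. near (relabel ident G) k (ident u) w \<and> {w, ident v} \<in> edges (relabel ident G)"
      using w Suc.IH[of w] relabel_edge[of w v] Suc.prems by blast
  qed
  then show ?case using Suc.IH[OF Suc.prems] by (simp only: near_Suc)
qed

lemma relabel_hop_ball:
  assumes "u \<in> verts G"
  shows "hop_ball (relabel ident G) k (ident u) = ident ` hop_ball G k u"
  using relabel_near[OF assms] by (auto simp: hop_ball_near)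

end


section \<open>Collecting neighborhoods in the LOCAL model\<close>

definition pairs_encode :: "(nat \<times> nat) set \<Rightarrow> nat" where
  "pairs_encode S = set_encode (prod_encode ` S)"

definition pairs_decode :: "nat \<Rightarrow> (nat \<times> nat) set" where
  "pairs_decode s = prod_decode ` set_decode s"

lemma pairs_inverse [simp]: "finite S \<Longrightarrow> pairs_decode (pairs_encode S) = S"
  by (simp add: pairs_encode_def pairs_decode_def image_image)

text \<open>The state of a flooding node as a number: the size of the graph, its own identifier, the
  known pairs of identifier and input, and the known edges as ordered pairs of identifiers.\<close>

definition kn_encode :: "nat \<Rightarrow> nat \<Rightarrow> (nat \<times> nat) set \<Rightarrow> (nat \<times> nat) set \<Rightarrow> nat" where
  "kn_encode n i S E = prod_encode (n, prod_encode (i, prod_encode (pairs_encode S, pairs_encode E)))"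

definition "kn_size s = fst (prod_decode s)"
definition "kn_self s = fst (prod_decode (snd (prod_decode s)))"
definition "kn_nodes s = pairs_decode (fst (prod_decode (snd (prod_decode (snd (prod_decode s))))))"
definition "kn_edges s = pairs_decode (snd (prod_decode (snd (prod_decode (snd (prod_decode s))))))"

lemma kn_inverse [simp]:
  "kn_size (kn_encode n i S E) = n" "kn_self (kn_encode n i S E) = i"
  "finite S \<Longrightarrow> kn_nodes (kn_encode n i S E) = S"
  "finite E \<Longrightarrow> kn_edges (kn_encode n i S E) = E"
  by (simp_all add: kn_encode_def kn_size_def kn_self_def kn_nodes_def kn_edges_def)

text \<open>Flooding: each message is the whole state of its sender, and the receiver also learns
  the edge over which the message came.\<close>

definition gather :: "(nat \<Rightarrow> nat \<Rightarrow> (nat \<times> nat) set \<Rightarrow> (nat \<times> nat) set \<Rightarrow> nat) \<Rightarrow> local_alg" where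
  "gather out = \<lparr>l_init = (\<lambda>n i x. kn_encode n i {(i, x)} {}), l_send = (\<lambda>s i. s),
     l_update = (\<lambda>s M. kn_encode (kn_size s) (kn_self s)
        (kn_nodes s \<union> (\<Union>(j, m)\<in>M. kn_nodes m))
        (kn_edges s \<union> (\<Union>(j, m)\<in>M. insert (kn_self s, j) (kn_edges m)))),
     l_output = (\<lambda>s. out (kn_size s) (kn_self s) (kn_nodes s) (kn_edges s))\<rparr>"

text \<open>After \<open>j\<close> rounds the edges at nodes at distance less than \<open>j\<close>
  are known. The first component is such a near end point, so an edge may be known in one direction
  only.\<close>

definition known_edges :: "graph \<Rightarrow> labelling \<Rightarrow> nat \<Rightarrow> nat \<Rightarrow> (nat \<times> nat) set" where
  "known_edges G ident j v = {(ident a, ident b) | a b. {a, b} \<in> edges G \<and> (\<exists>i<j. near G i v a)}"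

lemma known_edgesI:
  "{a, b} \<in> edges G \<Longrightarrow> near G i v a \<Longrightarrow> i < j \<Longrightarrow> (ident a, ident b) \<in> known_edges G ident j v"
  unfolding known_edges_def by blast

lemma finite_known_edges: assumes "simple_graph G" shows "finite (known_edges G ident j v)"
proof (rule finite_subset)
  show "known_edges G ident j v \<subseteq> ident ` verts G \<times> ident ` verts G"
    using edge_verts[OF assms] by (auto simp: known_edges_def)
qed (use assms in \<open>simp add: simple_graph_def\<close>)

lemma hop_ball_Suc:
  assumes "simple_graph G" "v \<in> verts G"
  shows "hop_ball G (Suc j) v = hop_ball G j v \<union> (\<Union>u\<in>neighbors G v. hop_ball G j u)"
  by (auto simp: hop_ball_near near_Suc2 neighbors_def)

lemma known_edges_Suc:
  assumes G: "simple_graph G" and v: "v \<in> verts G"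
  shows "known_edges G ident (Suc j) v =
    known_edges G ident j v \<union> (\<Union>u\<in>neighbors G v. insert (ident v, ident u) (known_edges G ident j u))"
    (is "?l = ?r")
proof
  show "?l \<subseteq> ?r"
  proof
    fix p assume "p \<in> ?l"
    then obtain a b i where p: "p = (ident a, ident b)" "{a, b} \<in> edges G" "i < Suc j" "near G i v a"
      by (auto simp: known_edges_def)
    show "p \<in> ?r"
    proof (cases i)
      \<comment> \<open>The edge starts at \<open>v\<close> itself; its other end is a neighbor,
        whose identifier comes with its message.\<close>
      case 0
      then show ?thesis using p by (auto simp: neighbors_def)
    next
      case (Suc i')
      then consider "near G i' v a" | u where "{v, u} \<in> edges G" "near G i' u a"
        using p(4) near_Suc2[of G i' v a] by blast
      then show ?thesis
      proof cases
        case 1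
        then have "p \<in> known_edges G ident j v" using p(1,3) Suc known_edgesI[OF p(2), of i' v j ident] by simp
        then show ?thesis by blast
      next
        case (2 u)
        then have "p \<in> known_edges G ident j u" using p(1,3) Suc known_edgesI[OF p(2), of i' u j ident] by simp
        then show ?thesis using 2(1) unfolding neighbors_def by blast
      qed
    qed
  qed
next
  have "(ident v, ident u) \<in> ?l" if "u \<in> neighbors G v" for u
    using that near_refl[of G 0 v] unfolding known_edges_def neighbors_def by blast
  moreover have "known_edges G ident j v \<subseteq> ?l"
    unfolding known_edges_def using less_SucI by blast
  moreover have "known_edges G ident j u \<subseteq> ?l" if "u \<in> neighbors G v" for u
  proof
    fix p assume "p \<in> known_edges G ident j u"
    then obtain a b i where p: "p = (ident a, ident b)" "{a, b} \<in> edges G" "i < j" "near G i u a"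
      by (auto simp: known_edges_def)
    have "near G (Suc i) v a" using that p(4) by (auto simp: neighbors_def near_Suc2)
    then show "p \<in> ?l" using p(1,3) known_edgesI[OF p(2), of "Suc i" v "Suc j" ident] by simp
  qed
  ultimately show "?r \<subseteq> ?l" by blast
qed

lemma gather_state:
  assumes G: "simple_graph G" and v: "v \<in> verts G"
  shows "local_state (gather out) G ident x j v =
    kn_encode (card (verts G)) (ident v) ((\<lambda>u. (ident u, x u)) ` hop_ball G j v) (known_edges G ident j v)"
  using v
proof (induction j arbitrary: v)
  case 0
  have "hop_ball G 0 v = {v}" using 0 by (auto simp: hop_ball_near)
  then show ?case by (simp add: gather_def known_edges_def)
next
  case (Suc j)
  have nb: "u \<in> verts G" if "u \<in> neighbors G v" for u
    using that edge_verts[OF G] by (auto simp: neighbors_def)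
  define st where "st = local_state (gather out) G ident x j"
  have S: "kn_nodes (st u) = (\<lambda>u. (ident u, x u)) ` hop_ball G j u"
    "kn_edges (st u) = known_edges G ident j u" "kn_self (st u) = ident u" "kn_size (st u) = card (verts G)"
    if "u \<in> verts G" for u
    using Suc.IH[OF that] finite_hop_ball[OF G] finite_known_edges[OF G] by (simp_all add: st_def)
  have "local_state (gather out) G ident x (Suc j) v = kn_encode (kn_size (st v)) (kn_self (st v))
        (kn_nodes (st v) \<union> (\<Union>u\<in>neighbors G v. kn_nodes (st u)))
        (kn_edges (st v) \<union> (\<Union>u\<in>neighbors G v. insert (kn_self (st v), ident u) (kn_edges (st u))))"
    by (simp add: gather_def st_def[unfolded gather_def])
  also have "\<dots> = kn_encode (card (verts G)) (ident v)
        ((\<lambda>u. (ident u, x u)) ` hop_ball G (Suc j) v) (known_edges G ident (Suc j) v)"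
    unfolding hop_ball_Suc[OF G Suc.prems] known_edges_Suc[OF G Suc.prems]
    using S Suc.prems nb by (simp add: image_Un image_UN)
  finally show ?case .
qed

definition known_graph :: "(nat \<times> nat) set \<Rightarrow> (nat \<times> nat) set \<Rightarrow> graph" where
  "known_graph S E = \<lparr>verts = fst ` S, edges = (\<lambda>(a, b). {a, b}) ` E\<rparr>"

text \<open>The number of nodes is passed on separately, because the collected graph does not
  determine it.\<close>

definition gather_out ::
  "(nat \<Rightarrow> graph \<Rightarrow> labelling \<Rightarrow> labelling) \<Rightarrow> nat \<Rightarrow> nat \<Rightarrow> (nat \<times> nat) set \<Rightarrow> (nat \<times> nat) set \<Rightarrow> nat" where
  "gather_out F n i S E = F n (known_graph S E) (\<lambda>u. THE z. (u, z) \<in> S) i"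

text \<open>After \<open>Suc T\<close> rounds the collected graph agrees with the relabelled one on
  the \<open>T\<close>-ball. The additional round reveals the edges between nodes at distance
  exactly \<open>T\<close>.\<close>

theorem gather_local_fun:
  assumes F: "local_fun T (F (card (verts G)))"
    and G: "simple_graph G" and inj: "inj_on ident (verts G)" and v: "v \<in> verts G"
  shows "local_result (gather (gather_out F)) (Suc T) G ident x v =
    F (card (verts G)) (relabel ident G) (transported G ident x) (ident v)"
proof -
  define S where "S = (\<lambda>u. (ident u, x u)) ` hop_ball G (Suc T) v"
  define E where "E = known_edges G ident (Suc T) v"
  let ?H = "known_graph S E" and ?G = "relabel ident G"
  have fin: "finite S" "finite E"
    using finite_hop_ball[OF G] finite_known_edges[OF G] by (simp_all add: S_def E_def)
  have res: "local_result (gather (gather_out F)) (Suc T) G ident x v = gather_out F (card (verts G)) (ident v) S E"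
    using gather_state[OF G v, of "gather_out F" ident x "Suc T"] fin v
    by (simp add: local_result_def gather_def S_def E_def del: local_state.simps)
  note sG = simple_relabel[OF G inj]
  have vH: "verts ?H = ident ` hop_ball G (Suc T) v" by (simp add: known_graph_def S_def image_image)
  have eH: "edges ?H = {ident ` {a, b} | a b. {a, b} \<in> edges G \<and> near G T v a}"
  proof
    show "edges ?H \<subseteq> {ident ` {a, b} | a b. {a, b} \<in> edges G \<and> near G T v a}"
    proof
      fix e assume "e \<in> edges ?H"
      then obtain a b i where "e = ident ` {a, b}" "{a, b} \<in> edges G" "i < Suc T" "near G i v a"
        by (auto simp: known_graph_def E_def known_edges_def)
      then show "e \<in> {ident ` {a, b} | a b. {a, b} \<in> edges G \<and> near G T v a}"
        using near_mono[of G i v a T] by auto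
    qed
    show "{ident ` {a, b} | a b. {a, b} \<in> edges G \<and> near G T v a} \<subseteq> edges ?H"
    proof
      fix e assume "e \<in> {ident ` {a, b} | a b. {a, b} \<in> edges G \<and> near G T v a}"
      then obtain a b where ab: "e = ident ` {a, b}" "{a, b} \<in> edges G" "near G T v a" by blast
      have "(ident a, ident b) \<in> E" unfolding E_def by (rule known_edgesI[OF ab(2,3)]) simp
      then show "e \<in> edges ?H" unfolding known_graph_def ab(1) by force
    qed
  qed
  have "hop_ball G (Suc T) v \<subseteq> verts G" by (simp add: hop_ball_near)
  then have sub1: "verts ?H \<subseteq> verts ?G" unfolding vH relabel_sel by (rule image_mono)
  have sub2: "edges ?H \<subseteq> edges ?G" unfolding eH relabel_sel by blast
  note sub = sub1 sub2
  have sH: "simple_graph ?H"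
    unfolding simple_graph_def
  proof (intro conjI ballI)
    show "finite (verts ?H)" using fin by (simp add: known_graph_def)
    fix e assume e: "e \<in> edges ?H"
    then show "card e = 2" using sub(2) sG by (auto simp: simple_graph_def)
    from e obtain a b where ab: "e = ident ` {a, b}" "{a, b} \<in> edges G" "near G T v a" unfolding eH by blast
    have "near G (Suc T) v a" "near G (Suc T) v b" using ab near_Suc by blast+
    then show "e \<subseteq> verts ?H" unfolding vH ab(1) using edge_verts[OF G ab(2)] by (auto simp: hop_ball_near)
  qed
  have agr: "agree T (ident v) ?G ?H"
  proof (rule agreeI[OF sub _ sG])
    show "hop_ball ?G T (ident v) \<subseteq> verts ?H"
      unfolding vH relabel_hop_ball[OF G inj v] by (intro image_mono hop_ball_mono) simp
    show "ident v \<in> verts ?G" using v by simp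
    fix a b assume ab: "{a, b} \<in> edges ?G" "a \<in> hop_ball ?G T (ident v)" "b \<in> hop_ball ?G T (ident v)"
    then obtain a' b' where *: "a = ident a'" "b = ident b'" "a' \<in> hop_ball G T v" "b' \<in> hop_ball G T v"
      unfolding relabel_hop_ball[OF G inj v] by blast
    then have "{a', b'} \<in> edges G" using relabel_edge[OF G inj, of a' b'] ab(1) by (simp add: hop_ball_near)
    moreover have "near G T v a'" using * by (simp add: hop_ball_near)
    ultimately show "{a, b} \<in> edges ?H" unfolding eH using * by auto
  qed
  have lab: "transported G ident x u = (THE z. (u, z) \<in> S)" if "u \<in> hop_ball ?G T (ident v)" for u
  proof -
    obtain w where w: "u = ident w" "w \<in> hop_ball G T v" using \<open>u \<in> _\<close> unfolding relabel_hop_ball[OF G inj v] by blast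
    have wV: "w \<in> verts G" using w by (simp add: hop_ball_near)
    have "(u, z) \<in> S \<longleftrightarrow> z = x w" for z
    proof
      assume "(u, z) \<in> S"
      then obtain w' where "ident w' = ident w" "z = x w'" "w' \<in> verts G" using w by (auto simp: S_def hop_ball_near)
      then show "z = x w" using inj wV by (auto dest: inj_onD)
    next
      assume "z = x w"
      then show "(u, z) \<in> S" using w hop_ball_mono[of T "Suc T" G v] by (auto simp: S_def)
    qed
    then show ?thesis using w wV transported_ident[OF G inj] by simp
  qed
  have "F (card (verts G)) ?G (transported G ident x) (ident v) =
      F (card (verts G)) ?H (\<lambda>u. THE z. (u, z) \<in> S) (ident v)"
    by (rule local_funD[OF F sG sH _ agr lab]) (use v in auto)
  then show ?thesis unfolding res gather_out_def by simp
qed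


section \<open>Simulating SLOCAL algorithms along a network decomposition\<close>

definition slocal_step ::
  "slocal_alg \<Rightarrow> nat \<Rightarrow> nat \<Rightarrow> graph \<Rightarrow> labelling \<Rightarrow> labelling \<Rightarrow> (nat \<rightharpoonup> nat) \<Rightarrow> nat \<Rightarrow> (nat \<rightharpoonup> nat)" where
  "slocal_step A n T G ident x mem v = mem(v \<mapsto> s_store A n (slocal_view T G ident x mem v))"

text \<open>The parameter n is not tied to the graph, so that a node can run the algorithm on its neighborhood.\<close>

definition slocal_run ::
  "slocal_alg \<Rightarrow> nat \<Rightarrow> nat \<Rightarrow> graph \<Rightarrow> labelling \<Rightarrow> labelling \<Rightarrow> nat list \<Rightarrow> (nat \<rightharpoonup> nat)" where
  "slocal_run A n T G ident x vs = foldl (slocal_step A n T G ident x) Map.empty vs"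

lemma slocal_run_Nil [simp]: "slocal_run A n T G ident x [] = Map.empty"
  by (simp add: slocal_run_def)

lemma slocal_run_snoc [simp]:
  "slocal_run A n T G ident x (vs @ [v]) = slocal_step A n T G ident x (slocal_run A n T G ident x vs) v"
  by (simp add: slocal_run_def)

lemma slocal_memory_run: "slocal_memory A T G ident x vs = slocal_run A (card (verts G)) T G ident x vs"
  by (simp add: slocal_memory_def slocal_run_def slocal_step_def[abs_def])

lemma slocal_run_None: "v \<notin> set vs \<Longrightarrow> slocal_run A n T G ident x vs v = None"
  by (induction vs rule: rev_induct) (auto simp: slocal_step_def)

lemma slocal_view_cong:
  assumes "\<And>u. u \<in> hop_ball G T v \<Longrightarrow> mem u = mem' u"
  shows "slocal_view T G ident x mem v = slocal_view T G ident x mem' v"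
  using assms by (auto simp: slocal_view_def)

text \<open>Views mention nodes only by their identifiers, so they do not change when the
  identifiers become the vertices.\<close>

lemma slocal_view_relabel:
  assumes G: "simple_graph G" and inj: "inj_on ident (verts G)" and v: "v \<in> verts G"
    and mem: "\<And>u. u \<in> verts G \<Longrightarrow> mem' (ident u) = mem u"
  shows "slocal_view T (relabel ident G) id (transported G ident x) mem' (ident v) = slocal_view T G ident x mem v"
proof -
  let ?B = "hop_ball G T v"
  have B: "?B \<subseteq> verts G" by (simp add: hop_ball_near)
  have 1: "(\<lambda>u. (id u, transported G ident x u, mem' u)) ` (ident ` ?B) = (\<lambda>u. (ident u, x u, mem u)) ` ?B"
    unfolding image_image
    by (rule image_cong) (use B mem transported_ident[OF G inj] in auto)
  have 2: "edges (induced (relabel ident G) (ident ` ?B)) = (`) ident ` edges (induced G ?B)"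
  proof -
    have "ident ` e \<subseteq> ident ` ?B \<longleftrightarrow> e \<subseteq> ?B" if "e \<in> edges G" for e
    proof -
      have "e \<subseteq> verts G" using G that by (auto simp: simple_graph_def)
      then show ?thesis using inj_on_image_mem_iff[OF inj _ B] by blast
    qed
    then show ?thesis by (auto simp: induced_def)
  qed
  show ?thesis
    unfolding slocal_view_def relabel_hop_ball[OF G inj v] using 1 2 by simp
qed

lemma slocal_run_relabel:
  assumes G: "simple_graph G" and inj: "inj_on ident (verts G)" and vs: "set vs \<subseteq> verts G"
    and v: "v \<in> verts G"
  shows "slocal_run A n T (relabel ident G) id (transported G ident x) (map ident vs) (ident v) =
    slocal_run A n T G ident x vs v"
  using vs v
proof (induction vs arbitrary: v rule: rev_induct)
  case (snoc w vs)
  have "ident v = ident w \<longleftrightarrow> v = w" using inj snoc.prems by (auto dest: inj_onD)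
  moreover have "slocal_view T (relabel ident G) id (transported G ident x)
      (slocal_run A n T (relabel ident G) id (transported G ident x) (map ident vs)) (ident w) =
      slocal_view T G ident x (slocal_run A n T G ident x vs) w"
  proof (rule slocal_view_relabel[OF G inj])
    fix u assume "u \<in> verts G"
    then show "slocal_run A n T (relabel ident G) id (transported G ident x) (map ident vs) (ident u) =
      slocal_run A n T G ident x vs u" 
      by (intro snoc.IH) (use snoc.prems(1) in simp_all)
  qed (use snoc.prems in simp)
  moreover have "slocal_run A n T (relabel ident G) id (transported G ident x) (map ident vs) (ident v) =
      slocal_run A n T G ident x vs v"
    by (intro snoc.IH) (use snoc.prems in simp_all)
  ultimately show ?case by (simp only: slocal_step_def slocal_run_snoc map_append list.map fun_upd_apply)
qed simp

lemma slocal_result_relabel: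
  assumes "simple_graph G" "inj_on ident (verts G)" "set vs = verts G" "v \<in> verts G"
  shows "slocal_result A T G ident x vs v =
    s_output A (the (slocal_run A (card (verts G)) T (relabel ident G) id (transported G ident x) (map ident vs) (ident v)))"
  using assms slocal_run_relabel[OF assms(1,2), of vs v] by (simp add: slocal_result_def slocal_memory_run)

text \<open>If \<open>S\<close> contains every earlier node that a node of \<open>S\<close> reads,
  the nodes outside \<open>S\<close> can be skipped without any effect on \<open>S\<close>.\<close>

lemma slocal_run_filter:
  assumes closed: "\<And>ys u zs w. xs = ys @ u # zs \<Longrightarrow> u \<in> S \<Longrightarrow> w \<in> set ys \<Longrightarrow> w \<in> hop_ball G T u \<Longrightarrow> w \<in> S"
    and "w \<in> S"
  shows "slocal_run A n T G ident x (filter (\<lambda>u. u \<in> S) xs) w = slocal_run A n T G ident x xs w"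
  using assms
proof (induction xs arbitrary: w rule: rev_induct)
  case (snoc u xs)
  have IH: "slocal_run A n T G ident x (filter (\<lambda>u. u \<in> S) xs) w = slocal_run A n T G ident x xs w" if "w \<in> S" for w
  proof (rule snoc.IH[OF _ that])
    fix ys u' zs w
    assume "xs = ys @ u' # zs" "u' \<in> S" "w \<in> set ys" "w \<in> hop_ball G T u'"
    then show "w \<in> S" using snoc.prems(1)[of ys u' "zs @ [u]" w] by simp
  qed
  show ?case
  proof (cases "u \<in> S")
    case False
    then show ?thesis using IH[OF snoc.prems(2)] snoc.prems(2) by (auto simp: slocal_step_def)
  next
    case True
    have "slocal_view T G ident x (slocal_run A n T G ident x (filter (\<lambda>u. u \<in> S) xs)) u =
        slocal_view T G ident x (slocal_run A n T G ident x xs) u"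
    proof (rule slocal_view_cong)
      fix w assume w: "w \<in> hop_ball G T u"
      show "slocal_run A n T G ident x (filter (\<lambda>u. u \<in> S) xs) w = slocal_run A n T G ident x xs w"
      proof (cases "w \<in> S")
        \<comment> \<open>Such a node has not been processed before \<open>u\<close>, so its memory
          is still empty in both runs.\<close>
        case False
        then have "w \<notin> set xs" using snoc.prems(1)[of xs u "[]" w] True w by auto
        then show ?thesis by (simp add: slocal_run_None)
      qed (rule IH)
    qed
    then show ?thesis using True IH[OF snoc.prems(2)] by (simp add: slocal_step_def)
  qed
qed simp

lemma insort_key_cong:
  "f x = g x \<Longrightarrow> (\<And>y. y \<in> set ys \<Longrightarrow> f y = g y) \<Longrightarrow> insort_key f x ys = insort_key g x ys"
  by (induction ys) auto

lemma sort_key_cong: "(\<And>y. y \<in> set xs \<Longrightarrow> f y = g y) \<Longrightarrow> sort_key f xs = sort_key g xs"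
proof (induction xs)
  case (Cons a xs)
  then have "sort_key f xs = sort_key g xs" by simp
  then show ?case using Cons.prems insort_key_cong[of f a g "sort_key g xs"] by simp
qed simp

lemma filter_sorted_list_of_set:
  assumes "finite V" "B \<subseteq> V"
  shows "filter (\<lambda>u. u \<in> B) (sorted_list_of_set V) = sorted_list_of_set B"
proof (rule sorted_distinct_set_unique)
  show "set (filter (\<lambda>u. u \<in> B) (sorted_list_of_set V)) = set (sorted_list_of_set B)"
    using assms finite_subset[OF assms(2,1)] by auto
qed (simp_all add: sorted_wrt_filter)

abbreviation "colour_of y u \<equiv> fst (the (y u))"

text \<open>Sorting by colour is stable, so equal colours are ordered by name. Thus all nodes agree
  on the relative order of the nodes that they know (\<open>schedule_filter\<close>).\<close>

definition schedule :: "(nat \<Rightarrow> (nat \<times> nat) option) \<Rightarrow> nat set \<Rightarrow> nat list" where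
  "schedule y B = sort_key (colour_of y) (sorted_list_of_set B)"

lemma schedule_filter:
  "finite V \<Longrightarrow> B \<subseteq> V \<Longrightarrow> filter (\<lambda>u. u \<in> B) (schedule y V) = schedule y B"
  by (simp add: schedule_def filter_sort filter_sorted_list_of_set)

lemma set_schedule: "finite B \<Longrightarrow> set (schedule y B) = B"
  by (simp add: schedule_def)

lemma distinct_schedule: "distinct (schedule y B)"
  by (simp add: schedule_def)

lemma schedule_order:
  assumes "schedule y B = ys @ u # zs" "w \<in> set ys" shows "colour_of y w \<le> colour_of y u"
proof -
  have "sorted (map (colour_of y) (schedule y B))" by (simp add: schedule_def)
  then show ?thesis using assms by (auto simp: sorted_append)
qed

text \<open>The set \<open>S\<close> below contains \<open>v\<close>, is closed under dependencies
  and fits into the ball of radius \<open>D\<close>. By \<open>slocal_run_filter\<close> both runs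
  have the same value at \<open>v\<close> as the run on \<open>S\<close> alone.\<close>

lemma schedule_run_local:
  assumes G: "simple_graph G"
    and near: "\<And>u p. u \<in> verts G \<Longrightarrow> y u = Some p \<Longrightarrow> near G \<rho> u (snd p) \<and> fst p < N"
    and total: "\<And>u. u \<in> verts G \<Longrightarrow> y u \<noteq> None"
    and sep: "\<And>u w p q. u \<in> verts G \<Longrightarrow> w \<in> verts G \<Longrightarrow> near G t u w \<Longrightarrow> y u = Some p \<Longrightarrow> y w = Some q \<Longrightarrow>
        fst p = fst q \<Longrightarrow> snd p = snd q"
    and v: "v \<in> verts G" and D: "N * (2 * \<rho> + t) \<le> D"
  shows "slocal_run A n t G ident x (schedule y (hop_ball G D v)) v = slocal_run A n t G ident x (schedule y (verts G)) v"
proof -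
  let ?V = "verts G" let ?B = "hop_ball G D v" let ?c = "colour_of y"
  define ctr where "ctr u = snd (the (y u))" for u
  have fin: "finite ?V" using G by (simp add: simple_graph_def)
  have BV: "?B \<subseteq> ?V" by (simp add: hop_ball_near)
  have nearc: "near G \<rho> u (ctr u)" and cN: "?c u < N" if "u \<in> ?V" for u
    using near[OF that] total[OF that] by (auto simp: ctr_def)
  have sepc: "ctr u = ctr w" if "u \<in> ?V" "w \<in> ?V" "near G t u w" "?c u = ?c w" for u w
    using sep[OF that(1-3)] total[OF that(1)] total[OF that(2)] that(4) by (auto simp: ctr_def)
  \<comment> \<open>Nodes of no larger colour whose cluster centre is near \<open>v\<close>; every
    decrease of the colour allows for a further distance of 2\<open>\<rho>\<close> +
    \<open>t\<close>.\<close>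
  define S where "S = {u \<in> ?V. ?c u \<le> ?c v \<and> near G (\<rho> + (?c v - ?c u) * (2 * \<rho> + t)) v (ctr u)}"
  have vS: "v \<in> S" using nearc[OF v] v by (simp add: S_def)
  have SB: "S \<subseteq> ?B"
  proof
    fix u assume u: "u \<in> S"
    then have uV: "u \<in> ?V" by (simp add: S_def)
    have "near G (\<rho> + (?c v - ?c u) * (2 * \<rho> + t) + \<rho>) v u"
      using near_trans[OF _ near_sym[OF nearc[OF uV]]] u by (simp add: S_def)
    \<comment> \<open>The colour decreases at most \<open>N - 1\<close> times. The first and the
      last \<open>\<rho>\<close> together fit into the remaining summand 2\<open>\<rho>\<close> +
      \<open>t\<close> of \<open>D\<close>.\<close>
    moreover have "(?c v - ?c u) * (2 * \<rho> + t) \<le> (N - 1) * (2 * \<rho> + t)"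
      using cN[OF v] by (intro mult_le_mono1) simp
    moreover have "N * (2 * \<rho> + t) = (N - 1) * (2 * \<rho> + t) + (2 * \<rho> + t)"
      using cN[OF v] by (cases N) auto
    ultimately have "near G D v u" using D by (elim near_mono) linarith
    then show "u \<in> ?B" using uV by (simp add: hop_ball_near)
  qed
  have closed: "w \<in> S" if "u \<in> S" "w \<in> ?V" "?c w \<le> ?c u" "near G t u w" for u w
  proof -
    have u: "u \<in> ?V" "?c u \<le> ?c v" "near G (\<rho> + (?c v - ?c u) * (2 * \<rho> + t)) v (ctr u)"
      using that(1) by (auto simp: S_def)
    show ?thesis
    proof (cases "?c w = ?c u")
      case True
      then show ?thesis using sepc[OF u(1) that(2,4)] u that(2) by (simp add: S_def)
    next
      case False
      then have lt: "?c w < ?c u" using that(3) by simp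
      \<comment> \<open>From the centre of the cluster of \<open>u\<close> to \<open>u\<close>, then
        to \<open>w\<close>, then to the centre of the cluster of \<open>w\<close>. With equal
        colours the centre stays the same, and nothing has to be paid.\<close>
      have "near G ((\<rho> + (?c v - ?c u) * (2 * \<rho> + t)) + \<rho> + t + \<rho>) v (ctr w)"
        using near_trans[OF near_trans[OF near_trans[OF u(3) near_sym[OF nearc[OF u(1)]]] that(4)] nearc[OF that(2)]] .
      moreover have "Suc (?c v - ?c u) * (2 * \<rho> + t) \<le> (?c v - ?c w) * (2 * \<rho> + t)"
        using lt u(2) by (intro mult_le_mono1) simp
      moreover have "(\<rho> + (?c v - ?c u) * (2 * \<rho> + t)) + \<rho> + t + \<rho> = \<rho> + Suc (?c v - ?c u) * (2 * \<rho> + t)"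
        by simp
      ultimately have "near G (\<rho> + (?c v - ?c w) * (2 * \<rho> + t)) v (ctr w)"
        by (metis add_le_cancel_left near_mono)
      then show ?thesis using that(2) lt u(2) by (simp add: S_def)
    qed
  qed
  have run: "slocal_run A n t G ident x (filter (\<lambda>u. u \<in> S) (schedule y W)) v = slocal_run A n t G ident x (schedule y W) v"
    if W: "W \<subseteq> ?V" for W
  proof (rule slocal_run_filter[OF _ vS])
    fix ys u zs w
    assume *: "schedule y W = ys @ u # zs" "u \<in> S" "w \<in> set ys" "w \<in> hop_ball G t u"
    show "w \<in> S"
      using closed[OF *(2) _ schedule_order[OF *(1,3)]] *(4) by (simp add: hop_ball_near)
  qed
  have "slocal_run A n t G ident x (schedule y ?B) v = slocal_run A n t G ident x (schedule y S) v"
    using run[OF BV] schedule_filter[OF finite_subset[OF BV fin] SB] by simp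
  also have "\<dots> = slocal_run A n t G ident x (schedule y ?V) v"
    using run[OF order_refl] schedule_filter[OF fin] SB BV by fastforce
  finally show ?thesis .
qed

definition simulate ::
  "slocal_alg \<Rightarrow> nat \<Rightarrow> nat \<Rightarrow> nat \<Rightarrow> graph \<Rightarrow> (nat \<Rightarrow> nat \<times> (nat \<times> nat) option) \<Rightarrow> nat \<Rightarrow> nat" where
  "simulate A n t D G z v = s_output A (the
     (slocal_run A n t G id (\<lambda>u. fst (z u)) (schedule (\<lambda>u. snd (z u)) (hop_ball G D v)) v))"

lemma slocal_run_cong:
  assumes "\<And>u mem. u \<in> set vs \<Longrightarrow> slocal_view t G ident x mem u = slocal_view t G' ident' x' mem u"
  shows "slocal_run A n t G ident x vs = slocal_run A n t G' ident' x' vs"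
  using assms by (induction vs rule: rev_induct) (auto simp: slocal_step_def)

text \<open>The nodes of the \<open>D\<close>-ball have views that reach \<open>t\<close>
  further.\<close>

lemma local_simulate: "local_fun (D + t) (simulate A n t D)"
  unfolding local_fun_def
proof (intro allI impI)
  fix G G' :: graph and z z' :: "nat \<Rightarrow> nat \<times> (nat \<times> nat) option" and v
  assume G: "simple_graph G" "simple_graph G'" "v \<in> verts G" "agree (D + t) v G G'"
    and z: "\<forall>u\<in>hop_ball G (D + t) v. z u = z' u"
  have hb: "hop_ball G D v = hop_ball G' D v"
    by (rule agree_hop_ball[OF G near_refl[of G 0]]) simp
  have fin: "finite (hop_ball G D v)" using G(1) by (rule finite_hop_ball)
  have zD: "z u = z' u" if "u \<in> hop_ball G D v" for u
    using z that hop_ball_mono[of D "D + t" G v] by auto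
  have sch: "schedule (\<lambda>u. snd (z u)) (hop_ball G D v) = schedule (\<lambda>u. snd (z' u)) (hop_ball G D v)"
    unfolding schedule_def by (rule sort_key_cong) (use zD fin in auto)
  have "slocal_run A n t G id (\<lambda>u. fst (z u)) (schedule (\<lambda>u. snd (z u)) (hop_ball G D v)) =
      slocal_run A n t G' id (\<lambda>u. fst (z' u)) (schedule (\<lambda>u. snd (z u)) (hop_ball G D v))"
  proof (rule slocal_run_cong)
    fix u and mem :: "nat \<rightharpoonup> nat" assume "u \<in> set (schedule (\<lambda>u. snd (z u)) (hop_ball G D v))"
    then have u: "u \<in> hop_ball G D v" using set_schedule[OF fin] by blast
    have ag: "agree t u G G'" by (rule agree_shift[OF G u]) simp
    have "hop_ball G t u \<subseteq> hop_ball G (D + t) v"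
      using u near_trans[of G D v u t] by (auto simp: hop_ball_near)
    then have "(\<lambda>w. (id w, fst (z w), mem w)) ` hop_ball G t u = (\<lambda>w. (id w, fst (z' w), mem w)) ` hop_ball G t u"
      using z by (intro image_cong) auto
    moreover have "edges (induced G (hop_ball G t u)) = edges (induced G' (hop_ball G t u))"
      using agree_edges[OF ag] by (auto simp: induced_def)
    ultimately show "slocal_view t G id (\<lambda>u. fst (z u)) mem u = slocal_view t G' id (\<lambda>u. fst (z' u)) mem u"
      unfolding slocal_view_def agree_hop_ball_eq[OF ag, symmetric] by simp
  qed
  then show "simulate A n t D G z v = simulate A n t D G' z' v"
    unfolding simulate_def hb[symmetric] sch[symmetric] by simp
qed


section \<open>Polylogarithmic functions\<close>

lemma ln_power_bigo_mono:
  assumes "k \<le> k'"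
  shows "(\<lambda>n. ln (real n) ^ k) \<in> O(\<lambda>n. ln (real n) ^ k')"
proof (rule landau_o.big_mono, rule eventually_mono[OF eventually_ge_at_top[of 3]])
  \<comment> \<open>From 3 on the logarithm is at least 1, so larger exponents give larger
    powers.\<close>
  fix n :: nat assume "3 \<le> n"
  then have "exp 1 \<le> real n" using exp_le by linarith
  then have "1 \<le> ln (real n)" by (subst ln_ge_iff) (use \<open>3 \<le> n\<close> in auto)
  then show "norm (ln (real n) ^ k) \<le> norm (ln (real n) ^ k')"
    using assms by (simp add: power_increasing)
qed

lemma polylog_const: "polylog (\<lambda>n. a)"
  unfolding polylog_def by (rule exI[of _ 0]) simp

lemma polylog_add:
  assumes "polylog f" "polylog g" shows "polylog (\<lambda>n. f n + g n)"
proof -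
  obtain i j where "(\<lambda>n. real (f n)) \<in> O(\<lambda>n. ln (real n) ^ i)" "(\<lambda>n. real (g n)) \<in> O(\<lambda>n. ln (real n) ^ j)"
    using assms unfolding polylog_def by blast
  then have "(\<lambda>n. real (f n)) \<in> O(\<lambda>n. ln (real n) ^ max i j)" "(\<lambda>n. real (g n)) \<in> O(\<lambda>n. ln (real n) ^ max i j)"
    using ln_power_bigo_mono[of i "max i j"] ln_power_bigo_mono[of j "max i j"] landau_o.big_trans by fastforce+
  then have "(\<lambda>n. real (f n) + real (g n)) \<in> O(\<lambda>n. ln (real n) ^ max i j)" by (rule sum_in_bigo)
  then show ?thesis unfolding polylog_def by auto
qed

lemma polylog_mult:
  assumes "polylog f" "polylog g" shows "polylog (\<lambda>n. f n * g n)"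
proof -
  obtain i j where "(\<lambda>n. real (f n)) \<in> O(\<lambda>n. ln (real n) ^ i)" "(\<lambda>n. real (g n)) \<in> O(\<lambda>n. ln (real n) ^ j)"
    using assms unfolding polylog_def by blast
  then have "(\<lambda>n. real (f n) * real (g n)) \<in> O(\<lambda>n. ln (real n) ^ i * ln (real n) ^ j)" by (rule landau_o.big.mult)
  then show ?thesis unfolding polylog_def power_add[symmetric] by auto
qed

lemma polylog_floor_log: "polylog floor_log"
proof -
  have "(\<lambda>n. real (floor_log n)) \<in> O(\<lambda>n. ln (real n) ^ 1)"
  proof (rule landau_o.bigI[of "1 / ln 2"])
    show "eventually (\<lambda>n. norm (real (floor_log n)) \<le> 1 / ln 2 * norm (ln (real n) ^ 1)) sequentially"
    proof (rule eventually_mono[OF eventually_ge_at_top[of 1]])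
      fix n :: nat assume n: "1 \<le> n"
      then have "0 \<le> log 2 (real n)" by simp
      then have "real (floor_log n) \<le> log 2 (real n)" using n by (simp add: floor_log_altdef)
      then show "norm (real (floor_log n)) \<le> 1 / ln 2 * norm (ln (real n) ^ 1)"
        using n by (simp add: log_def)
    qed
  qed simp
  then show ?thesis unfolding polylog_def by blast
qed

lemma polylog_Suc: "polylog f \<Longrightarrow> polylog (\<lambda>n. Suc (f n))"
  using polylog_add[OF _ polylog_const[of 1]] by simp

lemmas polylog_intros = polylog_const polylog_add polylog_mult polylog_Suc polylog_floor_log

lemma less_power_floor_log: "n < 2 ^ Suc (floor_log n)"
  using floor_log_exp2_gt[of n] by simp


section \<open>Every SLOCAL algorithm has a LOCAL counterpart\<close>

text \<open>The number of bits of the identifiers. The successor in the exponent keeps it positive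
  even for \<open>c = 0\<close>.\<close>

lemma power_floor_log_le: "n ^ c \<le> 2 ^ Suc (c * Suc (floor_log n))"
proof -
  have "n ^ c \<le> (2 ^ Suc (floor_log n)) ^ c" using less_power_floor_log[of n] by (intro power_mono) auto
  also have "\<dots> = 2 ^ (c * Suc (floor_log n))" by (simp only: power_mult[symmetric] mult.commute)
  also have "\<dots> \<le> 2 ^ Suc (c * Suc (floor_log n))" by simp
  finally show ?thesis .
qed

text \<open>The decomposition followed by the simulation is a local function of polylogarithmic
  radius. The resulting LOCAL algorithm computes exactly what the SLOCAL algorithm computes for one
  particular order.\<close>

theorem P_SLOCAL_subset_P_LOCAL: "P_SLOCAL \<subseteq> P_LOCAL"
proof
  fix Q assume Q: "Q \<in> P_SLOCAL"
  show "Q \<in> P_LOCAL" unfolding P_LOCAL_def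
  proof (intro CollectI allI)
    fix c
    obtain A t where t: "polylog t" and A: "\<And>G ident x vs. simple_graph G \<Longrightarrow> id_assignment c G ident \<Longrightarrow>
        instances Q G x \<Longrightarrow> distinct vs \<Longrightarrow> set vs = verts G \<Longrightarrow>
        admissible Q G x (slocal_result A (t (card (verts G))) G ident x vs)"
      using Q unfolding P_SLOCAL_def by blast
    \<comment> \<open>\<open>N\<close> colours, \<open>b\<close> bits of the identifiers and
      \<open>R\<close> steps per bit; \<open>\<rho>\<close> bounds the distance to the node naming a
      cluster, \<open>M\<close> is the radius seen by a clustering step, \<open>D\<close> the radius
      of the simulation. \<open>T\<close> adds up the radii of the decomposition and of the
      simulation.\<close>
    define N where "N n = Suc (floor_log n)" for n
    define b where "b n = Suc (c * Suc (floor_log n))" for n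
    define R where "R n = 2 * b n * Suc (floor_log n)" for n
    define \<rho> where "\<rho> n = b n * R n * t n" for n
    define M where "M n = 2 * \<rho> n + 3 * t n" for n
    define D where "D n = N n * (2 * \<rho> n + t n)" for n
    define T where "T n = N n * ((b n * R n) * (M n + t n)) + (D n + t n)" for n
    define dec :: "nat \<Rightarrow> graph \<Rightarrow> labelling \<Rightarrow> nat \<Rightarrow> (nat \<times> nat) option" where
      "dec n = decomposition (t n) (M n) (2 * b n) (R n) (b n * R n) (N n)" for n
    define F where "F n G x = simulate A n (t n) (D n) G (\<lambda>v. (x v, dec n G x v))" for n G x
    have pl: "polylog (\<lambda>n. Suc (T n))"
      unfolding T_def D_def M_def \<rho>_def R_def b_def N_def by (intro polylog_intros t)
    have loc: "local_fun (T n) (F n)" for n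
      unfolding F_def T_def dec_def
      by (rule local_fun_comp[OF local_fun_pair[OF local_fun_id local_decomposition] local_simulate order_refl])
    show "\<exists>A t. polylog t \<and> (\<forall>G ident x. simple_graph G \<longrightarrow> id_assignment c G ident \<longrightarrow> instances Q G x \<longrightarrow>
        admissible Q G x (local_result A (t (card (verts G))) G ident x))"
    proof (intro exI conjI allI impI)
      show "polylog (\<lambda>n. Suc (T n))" by (rule pl)
      fix G ident x
      assume G: "simple_graph G" and id: "id_assignment c G ident" and x: "instances Q G x"
      define n where "n = card (verts G)"
      let ?H = "relabel ident G" and ?x = "transported G ident x"
      have inj: "inj_on ident (verts G)" using id by (simp add: id_assignment_def)
      note H = simple_relabel[OF G inj]
      have cH: "card (verts ?H) = n" using card_relabel[OF G inj] by (simp add: n_def)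
      have names: "verts ?H \<subseteq> {..<2 ^ b n}"
      proof -
        have "verts ?H \<subseteq> {..<n ^ c}" using id by (simp add: id_assignment_def n_def)
        then show ?thesis using power_floor_log_le[of n c] unfolding b_def by force
      qed
      have R: "(2 * b n) ^ R n * card (verts ?H) < Suc (2 * b n) ^ R n"
        unfolding R_def cH by (rule growth_exceeds) (use less_power_floor_log in \<open>simp_all add: b_def\<close>)
      have b: "b n > 0" by (simp add: b_def)
      have M: "2 * (b n * R n * t n) + 3 * t n \<le> M n" by (simp add: M_def \<rho>_def)
      define y where "y = dec n ?H ?x"
      note d = H R refl b names M
      \<comment> \<open>The schedule as an order of the original vertices. The SLOCAL algorithm is
        correct for every order, hence also for one that depends on the decomposition.\<close>
      define vs where "vs = map (inv_into (verts G) ident) (schedule y (verts ?H))"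
      have fin: "finite (verts ?H)" using H by (simp add: simple_graph_def)
      have setH: "set (schedule y (verts ?H)) = verts ?H" by (rule set_schedule[OF fin])
      have vs_id: "map ident vs = schedule y (verts ?H)"
        unfolding vs_def map_map
        by (rule map_idI) (use setH in \<open>auto simp: f_inv_into_f\<close>)
      have set_vs: "set vs = verts G"
        using inj unfolding vs_def set_map setH by simp
      have "distinct vs"
        using distinct_schedule[of y "verts ?H"] unfolding vs_id[symmetric] by (simp add: distinct_map)
      have "local_result (gather (gather_out F)) (Suc (T n)) G ident x = slocal_result A (t n) G ident x vs"
      proof
        fix v
        show "local_result (gather (gather_out F)) (Suc (T n)) G ident x v = slocal_result A (t n) G ident x vs v"
        proof (cases "v \<in> verts G")
          case False
          then show ?thesis by (simp add: local_result_def slocal_result_def)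
        next
          case True
          have "slocal_run A n (t n) ?H id ?x (schedule y (hop_ball ?H (D n) (ident v))) (ident v) =
              slocal_run A n (t n) ?H id ?x (schedule y (verts ?H)) (ident v)"
          proof (rule schedule_run_local[OF H, where \<rho> = "\<rho> n" and N = "N n"])
            show "near ?H (\<rho> n) u (snd p) \<and> fst p < N n" if "u \<in> verts ?H" "y u = Some p" for u p
              using decomposition_near[OF d that(1), of "N n" ?x "fst p" "snd p"] that(2)
              by (simp add: y_def dec_def \<rho>_def)
            show "y u \<noteq> None" if "u \<in> verts ?H" for u
              unfolding y_def dec_def
              by (rule decomposition_total[OF d _ that]) (use less_power_floor_log cH in \<open>simp add: N_def\<close>)
            show "snd p = snd q" if "u \<in> verts ?H" "w \<in> verts ?H" "near ?H (t n) u w" "y u = Some p" "y w = Some q"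
              "fst p = fst q" for u w p q
              using decomposition_separated[OF d that(1-3), of "N n" ?x "fst p" "snd p" "snd q"] that(4-6)
              by (cases p; cases q) (simp add: y_def dec_def)
            show "ident v \<in> verts ?H" using True by simp
          qed (simp add: D_def)
          then have "F n ?H ?x (ident v) = s_output A (the (slocal_run A n (t n) ?H id ?x (schedule y (verts ?H)) (ident v)))"
            by (simp add: F_def simulate_def y_def)
          moreover have "local_fun (T n) (F (card (verts G)))" using loc[of n] by (simp add: n_def)
          ultimately show ?thesis
            using gather_local_fun[OF _ G inj True, of "T n" F x] slocal_result_relabel[OF G inj set_vs True, of A "t n" x]
            by (simp add: n_def vs_id)
        qed
      qed
      then show "admissible Q G x (local_result (gather (gather_out F)) (Suc (T (card (verts G)))) G ident x)"
        using A[OF G id x \<open>distinct vs\<close> set_vs] by (simp add: n_def)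
    qed
  qed
qed


section \<open>Neighborhood covers from sequentially grown cores\<close>

text \<open>
  A core consists of its centre, its colour, its nodes and the nodes that it blocks for its colour.
\<close>

type_synonym core = "nat \<times> nat \<times> nat set \<times> nat set"

definition covered :: "core set \<Rightarrow> nat \<Rightarrow> bool" where
  "covered H u \<longleftrightarrow> (\<exists>w k Z Y. (w, k, Z, Y) \<in> H \<and> u \<in> Z)"

definition blocked :: "core set \<Rightarrow> nat \<Rightarrow> nat set" where
  "blocked H u = {k. \<exists>w Z Y. (w, k, Z, Y) \<in> H \<and> u \<in> Y}"

definition weight :: "core set \<Rightarrow> nat \<Rightarrow> nat" where
  "weight H u = 2 ^ card (blocked H u)"

definition free :: "core set \<Rightarrow> nat \<Rightarrow> nat \<Rightarrow> bool" where
  "free H k u \<longleftrightarrow> \<not> covered H u \<and> k \<notin> blocked H u"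

text \<open>Distances are taken in the whole graph: only the end points of a step have to be free,
  not the nodes in between.\<close>

primrec grow :: "graph \<Rightarrow> nat \<Rightarrow> core set \<Rightarrow> nat \<Rightarrow> nat \<Rightarrow> nat \<Rightarrow> nat set" where
  "grow G r H k w 0 = {w}"
| "grow G r H k w (Suc j) = {u \<in> verts G. free H k u \<and> (\<exists>z\<in>grow G r H k w j. near G (2 * r) z u)}"

definition valid :: "graph \<Rightarrow> nat \<Rightarrow> nat \<Rightarrow> core set \<Rightarrow> core \<Rightarrow> bool" where
  "valid G r l H = (\<lambda>(w, k, Z, Y). w \<in> verts G \<and> k \<le> l \<and> free H k w \<and>
     (\<exists>j\<le>l. Z = grow G r H k w j \<and> Y = grow G r H k w (Suc j) - Z \<and> sum (weight H) Y \<le> sum (weight H) Z))"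

text \<open>This abstracts from the order of processing: a new core only has to be valid with
  respect to the cores that exist when it is added.\<close>

inductive good :: "graph \<Rightarrow> nat \<Rightarrow> nat \<Rightarrow> core set \<Rightarrow> bool" for G r l where
  good_empty: "good G r l {}"
| good_insert: "good G r l H \<Longrightarrow> valid G r l H c \<Longrightarrow> good G r l (insert c H)"

text \<open>The cluster that belongs to a core.\<close>

definition expansion :: "graph \<Rightarrow> nat \<Rightarrow> nat set \<Rightarrow> nat set" where
  "expansion G r Z = {v \<in> verts G. \<exists>z\<in>Z. near G r z v}"

text \<open>Properties of a core that do not refer to the other cores and hence persist when further
  ones are added.\<close>

definition well_formed :: "graph \<Rightarrow> nat \<Rightarrow> nat \<Rightarrow> core \<Rightarrow> bool" where
  "well_formed G r l = (\<lambda>(w, k, Z, Y). w \<in> Z \<and> w \<in> verts G \<and> k \<le> l \<and> Z \<subseteq> verts G \<and> Y \<subseteq> verts G \<and>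
     (\<forall>u\<in>Z \<union> Y. near G (Suc l * (2 * r)) w u) \<and>
     (\<forall>z\<in>Z. near (induced G (expansion G r Z)) (l * (2 * r)) w z))"

text \<open>A walk of length at most \<open>r\<close> from a node of \<open>Z\<close> does not leave
  the expansion.\<close>

lemma near_expansion:
  assumes G: "simple_graph G" and z: "z \<in> Z" "z \<in> verts G" and "i \<le> r" "near G i z m"
  shows "near (induced G (expansion G r Z)) i z m"
  using assms(4,5)
proof (induction i arbitrary: m)
  case (Suc i)
  from Suc.prems(2) consider "near G i z m" | q where "near G i z q" "{q, m} \<in> edges G"
    by (auto simp: near_Suc)
  then show ?case
  proof cases
    case 1
    then show ?thesis using Suc by (simp add: near_Suc)
  next
    case (2 q)
    have "near G r z q" using near_mono[OF 2(1)] Suc.prems(1) by simp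
    moreover have "near G r z m" using near_mono[OF Suc.prems(2)] Suc.prems(1) by simp
    ultimately have "{q, m} \<in> edges (induced G (expansion G r Z))"
      using 2(2) edge_verts[OF G 2(2)] z(1) by (auto simp: induced_def expansion_def)
    then show ?thesis using Suc.IH[OF _ 2(1)] Suc.prems(1) by (auto simp: near_Suc)
  qed
qed simp

lemma expansion_mono: "Z \<subseteq> Z' \<Longrightarrow> expansion G r Z \<subseteq> expansion G r Z'"
  by (auto simp: expansion_def)

lemma induced_edges_mono: "C \<subseteq> C' \<Longrightarrow> edges (induced G C) \<subseteq> edges (induced G C')"
  by (auto simp: induced_def)

lemma covered_insert: "covered (insert (w, k, Z, Y) H) u \<longleftrightarrow> u \<in> Z \<or> covered H u"
  by (auto simp: covered_def)

lemma blocked_insert: "blocked (insert (w, k, Z, Y) H) u = (if u \<in> Y then insert k (blocked H u) else blocked H u)"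
  by (auto simp: blocked_def)

lemma covered_mono: "covered H u \<Longrightarrow> H \<subseteq> H' \<Longrightarrow> covered H' u"
  unfolding covered_def by blast

lemma blocked_mono: "H \<subseteq> H' \<Longrightarrow> blocked H u \<subseteq> blocked H' u"
  unfolding blocked_def by blast

lemma finite_blocked: "finite H \<Longrightarrow> finite (blocked H u)"
  by (rule finite_subset[of _ "(fst \<circ> snd) ` H"]) (force simp: blocked_def)+

section \<open>Properties of good sets of cores\<close>

context
  fixes G :: graph and r l :: nat
  assumes G: "simple_graph G"
begin

lemma grow_free:
  assumes "w \<in> verts G" "free H k w" shows "u \<in> grow G r H k w j \<Longrightarrow> u \<in> verts G \<and> free H k u"
  using assms by (cases j) auto

lemma grow_Suc_mono:
  assumes "w \<in> verts G" "free H k w" shows "grow G r H k w j \<subseteq> grow G r H k w (Suc j)"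
proof
  fix u assume u: "u \<in> grow G r H k w j"
  then show "u \<in> grow G r H k w (Suc j)" unfolding grow.simps using grow_free[OF assms u] near_refl[of G "2 * r" u] by blast
qed

lemma grow_near: "u \<in> grow G r H k w j \<Longrightarrow> near G (j * (2 * r)) w u"
proof (induction j arbitrary: u)
  case (Suc j)
  then obtain z where z: "z \<in> grow G r H k w j" "near G (2 * r) z u" by auto
  from near_trans[OF Suc.IH[OF z(1)] z(2)] show ?case by (simp add: add.commute)
qed simp

lemma finite_grow: assumes "w \<in> verts G" "free H k w" shows "finite (grow G r H k w j)"
proof (rule finite_subset)
  show "grow G r H k w j \<subseteq> verts G" using grow_free[OF assms] by blast
qed (use G in \<open>simp add: simple_graph_def\<close>)

text \<open>A step of length 2\<open>r\<close> is cut in the middle. Each half has length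
  \<open>r\<close> and an end in the core, so \<open>near_expansion\<close> keeps it inside the
  cluster.\<close>

lemma grow_connected:
  assumes w: "w \<in> verts G" "free H k w"
  shows "z \<in> grow G r H k w j \<Longrightarrow> near (induced G (expansion G r (grow G r H k w j))) (j * (2 * r)) w z"
proof (induction j arbitrary: z)
  case (Suc j)
  let ?I = "induced G (expansion G r (grow G r H k w (Suc j)))"
  obtain y where y: "y \<in> grow G r H k w j" "near G (2 * r) y z" using Suc.prems by auto
  have "near G (r + r) y z" using y(2) by (simp add: mult_2)
  then obtain m where m: "near G r y m" "near G r m z" by (rule near_split)
  have y': "y \<in> grow G r H k w (Suc j)" using y(1) grow_Suc_mono[OF w] by blast
  have "near ?I r y m" using near_expansion[OF G y' _ _ m(1)] grow_free[OF w y'] by simp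
  moreover have "near ?I r z m"
    using near_expansion[OF G Suc.prems _ _ near_sym[OF m(2)]] grow_free[OF w Suc.prems] by simp
  ultimately have yz: "near ?I (r + r) y z" by (metis near_sym near_trans)
  have "near ?I (j * (2 * r)) w y"
    by (rule near_edges_mono[OF _ Suc.IH[OF y(1)]]) (intro induced_edges_mono expansion_mono grow_Suc_mono w)
  from near_trans[OF this yz] show ?case by (simp add: mult_2 add.commute)
qed simp

lemma grow_mono:
  assumes "w \<in> verts G" "free H k w" "i \<le> j" shows "grow G r H k w i \<subseteq> grow G r H k w j"
  using assms(3)
proof (induction rule: dec_induct)
  case (step n)
  then show ?case using grow_Suc_mono[OF assms(1,2), of n] by blast
qed simp

lemma valid_well_formed:
  assumes "valid G r l H c" shows "well_formed G r l c"
proof -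
  obtain w k Z Y where c: "c = (w, k, Z, Y)" by (cases c)
  from assms obtain j where w: "w \<in> verts G" "free H k w" and k: "k \<le> l" and j: "j \<le> l"
    and ZY: "Z = grow G r H k w j" "Y = grow G r H k w (Suc j) - Z"
    unfolding c valid_def by blast
  have "w \<in> Z" unfolding ZY using grow_mono[OF w, of 0 j] by simp
  moreover have ZYs: "Z \<union> Y \<subseteq> grow G r H k w (Suc j)" using ZY grow_Suc_mono[OF w] by blast
  then have "Z \<subseteq> verts G" "Y \<subseteq> verts G" using grow_free[OF w] by blast+
  moreover have "near G (Suc l * (2 * r)) w u" if "u \<in> Z \<union> Y" for u
  proof -
    have "near G (Suc j * (2 * r)) w u" using ZYs that grow_near by blast
    then show ?thesis by (rule near_mono) (use j in \<open>intro mult_le_mono1, simp\<close>)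
  qed
  moreover have "near (induced G (expansion G r Z)) (l * (2 * r)) w z" if "z \<in> Z" for z
  proof -
    have "near (induced G (expansion G r Z)) (j * (2 * r)) w z"
      using grow_connected[OF w, of z j] that unfolding ZY by blast
    then show ?thesis by (rule near_mono) (use j in simp)
  qed
  ultimately show ?thesis unfolding c well_formed_def using w k by blast
qed

lemma good_well_formed: "good G r l H \<Longrightarrow> c \<in> H \<Longrightarrow> well_formed G r l c"
  by (induction rule: good.induct) (auto intro: valid_well_formed)

lemma good_finite: "good G r l H \<Longrightarrow> finite H"
  by (induction rule: good.induct) auto

text \<open>When the core was added, a node within 2\<open>r\<close> of it that was free for its
  colour belonged to the next layer, so it became part of the core or was blocked. Later cores do
  not undo this.\<close>

lemma good_shielded:
  assumes "good G r l H"
  shows "(w, k, Z, Y) \<in> H \<Longrightarrow> z \<in> Z \<Longrightarrow> u \<in> verts G \<Longrightarrow> near G (2 * r) z u \<Longrightarrow> covered H u \<or> k \<in> blocked H u"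
  using assms
proof (induction arbitrary: w k Z Y rule: good.induct)
  case (good_insert H c)
  show ?case
  proof (cases "(w, k, Z, Y) = c")
    case False
    then have "covered H u \<or> k \<in> blocked H u" using good_insert by blast
    then show ?thesis
      using covered_mono[OF _ subset_insertI[of H c]] blocked_mono[OF subset_insertI[of H c], of u] by blast
  next
    case True
    from good_insert.hyps(2) obtain j where ZY: "Z = grow G r H k w j" "Y = grow G r H k w (Suc j) - Z"
      unfolding True[symmetric] valid_def by blast
    show ?thesis
    proof (cases "free H k u")
      case False
      then show ?thesis unfolding free_def
        using covered_mono[OF _ subset_insertI[of H c]] blocked_mono[OF subset_insertI[of H c], of u] by blast
    next
      case free: True
      then have "u \<in> grow G r H k w (Suc j)" using good_insert.prems ZY(1) by auto
      then have "u \<in> Z \<or> u \<in> Y" using ZY by blast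
      then show ?thesis unfolding True[symmetric] covered_insert blocked_insert by auto
    qed
  qed
qed simp

lemma valid_uncovered:
  assumes "valid G r l H (w, k, Z, Y)" "z \<in> Z \<union> Y" shows "free H k z"
proof -
  from assms(1) obtain j where w: "w \<in> verts G" "free H k w"
    and ZY: "Z = grow G r H k w j" "Y = grow G r H k w (Suc j) - Z"
    unfolding valid_def by blast
  then show ?thesis using grow_free[OF w] assms(2) by blast
qed

text \<open>The nodes of the later core were free for its colour when it was added, whereas the
  earlier core was covered and, by \<open>good_shielded\<close>, surrounded by nodes that were not
  free for its own colour.\<close>

lemma good_separated:
  assumes "good G r l H"
  shows "(w, k, Z, Y) \<in> H \<Longrightarrow> (w', k', Z', Y') \<in> H \<Longrightarrow> (w, k, Z, Y) \<noteq> (w', k', Z', Y') \<Longrightarrow> z \<in> Z \<Longrightarrow> z' \<in> Z' \<Longrightarrow>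
    z \<noteq> z' \<and> (k = k' \<longrightarrow> \<not> near G (2 * r) z z')"
  using assms
proof (induction arbitrary: w k Z Y w' k' Z' Y' z z' rule: good.induct)
  case (good_insert H c)
  have new: "y \<noteq> y' \<and> (i = i' \<longrightarrow> \<not> near G (2 * r) y y')"
    if old: "(x, i, A, B) \<in> H" and c: "(x', i', A', B') = c" and y: "y \<in> A" "y' \<in> A'" for x i A B x' i' A' B' y y'
  proof -
    have v: "valid G r l H (x', i', A', B')" using good_insert.hyps(2) c by simp
    have fr: "free H i' y'" using valid_uncovered[OF v] y(2) by simp
    have y'V: "y' \<in> verts G" using valid_well_formed[OF v] y(2) by (auto simp: well_formed_def)
    have "covered H y" using old y(1) by (auto simp: covered_def)
    moreover have "\<not> near G (2 * r) y y'" if "i = i'"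
      using good_shielded[OF good_insert.hyps(1) old y(1) y'V] fr that by (auto simp: free_def)
    ultimately show ?thesis using fr by (auto simp: free_def)
  qed
  consider "(w, k, Z, Y) \<in> H" "(w', k', Z', Y') \<in> H" | "(w, k, Z, Y) \<in> H" "(w', k', Z', Y') = c"
    | "(w', k', Z', Y') \<in> H" "(w, k, Z, Y) = c" using good_insert.prems(1-3) by auto
  then show ?case
  proof cases
    case 1
    then show ?thesis using good_insert.IH[OF 1 good_insert.prems(3-5)] by simp
  next
    case 2
    then show ?thesis using new[OF 2 good_insert.prems(4,5)] by simp
  next
    case 3
    then show ?thesis using new[OF 3 good_insert.prems(5,4)] near_sym by blast
  qed
qed simp

text \<open>
  The nodes of a new core stop counting, and their weight pays for the doubling of the weights of
  the nodes that it blocks.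
\<close>

lemma good_weight:
  assumes "good G r l H"
  shows "(\<Sum>u | u \<in> verts G \<and> \<not> covered H u. weight H u) \<le> card (verts G)"
  using assms
proof (induction rule: good.induct)
  case good_empty
  then show ?case by (simp add: covered_def weight_def blocked_def)
next
  case (good_insert H c)
  obtain w k Z Y where c: "c = (w, k, Z, Y)" by (cases c)
  have v: "valid G r l H (w, k, Z, Y)" using good_insert.hyps(2) c by simp
  have fin: "finite (verts G)" using G by (simp add: simple_graph_def)
  have ZY: "Z \<subseteq> verts G" "Y \<subseteq> verts G" using valid_well_formed[OF v] by (auto simp: well_formed_def)
  have disj: "Z \<inter> Y = {}" and le: "sum (weight H) Y \<le> sum (weight H) Z" using v by (auto simp: valid_def)
  have fr: "free H k u" if "u \<in> Z \<union> Y" for u by (rule valid_uncovered[OF v that])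
  let ?U = "{u. u \<in> verts G \<and> \<not> covered H u}"
  have ZU: "Z \<subseteq> ?U" "Y \<subseteq> ?U - Z" using ZY fr disj by (auto simp: free_def)
  have finU: "finite ?U" using fin by simp
  have U': "{u. u \<in> verts G \<and> \<not> covered (insert c H) u} = ?U - Z" unfolding c covered_insert by auto
  have wY: "weight (insert c H) u = 2 * weight H u" if "u \<in> Y" for u
  proof -
    have "k \<notin> blocked H u" using fr that by (simp add: free_def)
    then show ?thesis using that finite_blocked[OF good_finite[OF good_insert.hyps(1)]]
      unfolding c by (simp add: weight_def blocked_insert)
  qed
  have wN: "weight (insert c H) u = weight H u" if "u \<notin> Y" for u
    using that unfolding c by (simp add: weight_def blocked_insert)
  have "sum (weight (insert c H)) (?U - Z) = sum (weight (insert c H)) (?U - Z - Y) + sum (weight (insert c H)) Y"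
    using ZU(2) finU by (intro sum.subset_diff) auto
  also have "\<dots> = sum (weight H) (?U - Z - Y) + 2 * sum (weight H) Y"
    using wY wN by (simp add: sum_distrib_left)
  also have "\<dots> = (sum (weight H) (?U - Z - Y) + sum (weight H) Y) + sum (weight H) Y" by simp
  also have "sum (weight H) (?U - Z - Y) + sum (weight H) Y = sum (weight H) (?U - Z)"
    using ZU(2) finU by (intro sum.subset_diff[symmetric]) auto
  also have "sum (weight H) (?U - Z) + sum (weight H) Y \<le> sum (weight H) (?U - Z) + sum (weight H) Z"
    using le by simp
  also have "\<dots> = sum (weight H) ?U"
    using ZU(1) finU by (intro sum.subset_diff[symmetric]) auto
  also have "\<dots> \<le> card (verts G)" by (rule good_insert.IH)
  finally show ?case unfolding U' .
qed

text \<open>By \<open>good_weight\<close> the uncovered nodes weigh less than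
  \<open>2 ^ Suc l\<close> in total. So \<open>w\<close> is blocked for at most \<open>l\<close> of
  the \<open>Suc l\<close> colours, and a core growing from \<open>w\<close> cannot double its
  weight \<open>Suc l\<close> times.\<close>

lemma valid_exists:
  assumes H: "good G r l H" and l: "card (verts G) < 2 ^ Suc l" and w: "w \<in> verts G" "\<not> covered H w"
  shows "\<exists>k Z Y. valid G r l H (w, k, Z, Y)"
proof -
  let ?U = "{u. u \<in> verts G \<and> \<not> covered H u}"
  have finU: "finite ?U" using G by (simp add: simple_graph_def)
  have sub: "sum (weight H) A < 2 ^ Suc l" if "A \<subseteq> ?U" for A
    using sum_mono2[OF finU that, of "weight H"] good_weight[OF H] l by simp
  have "weight H w < 2 ^ Suc l" using sub[of "{w}"] w by simp
  then have "card (blocked H w) < Suc l" unfolding weight_def by (rule power_less_imp_less_exp[rotated]) simp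
  then have "\<not> {..l} \<subseteq> blocked H w"
    using card_mono[OF finite_blocked[OF good_finite[OF H]], of "{..l}" w] by auto
  then obtain k where k: "k \<le> l" "k \<notin> blocked H w" by auto
  then have fr: "free H k w" using w by (simp add: free_def)
  let ?Z = "grow G r H k w"
  have "\<exists>j\<le>l. sum (weight H) (?Z (Suc j) - ?Z j) \<le> sum (weight H) (?Z j)"
  proof (rule ccontr)
    assume "\<not> ?thesis"
    then have big: "sum (weight H) (?Z j) < sum (weight H) (?Z (Suc j) - ?Z j)" if "j \<le> l" for j
      using that by (meson not_le)
    have "2 ^ j \<le> sum (weight H) (?Z j)" if "j \<le> Suc l" for j
      using that
    proof (induction j)
      case 0
      then show ?case by (simp add: weight_def)
    next
      case (Suc j)
      have "sum (weight H) (?Z (Suc j)) = sum (weight H) (?Z (Suc j) - ?Z j) + sum (weight H) (?Z j)"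
        by (rule sum.subset_diff[OF grow_Suc_mono[OF w(1) fr] finite_grow[OF w(1) fr]])
      then show ?case using Suc big[of j] by (simp del: grow.simps)
    qed
    from this[of "Suc l"] have "2 ^ Suc l \<le> sum (weight H) (?Z (Suc l))" by simp
    moreover have "?Z (Suc l) \<subseteq> ?U" using grow_free[OF w(1) fr] by (auto simp: free_def simp del: grow.simps)
    ultimately show False using sub by (meson not_le)
  qed
  then obtain j where "j \<le> l" "sum (weight H) (?Z (Suc j) - ?Z j) \<le> sum (weight H) (?Z j)" by blast
  then have "valid G r l H (w, k, ?Z j, ?Z (Suc j) - ?Z j)"
    unfolding valid_def using w(1) k(1) fr by blast
  then show ?thesis by blast
qed

end


section \<open>Computing a neighborhood cover in the SLOCAL model\<close>

text \<open>The added cores are kept apart from \<open>H\<close>, because a node stores only the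
  cores that it has created itself.\<close>

inductive ext :: "graph \<Rightarrow> nat \<Rightarrow> nat \<Rightarrow> nat set \<Rightarrow> core set \<Rightarrow> core set \<Rightarrow> bool" for G r l B H where
  ext_empty: "ext G r l B H {}"
| ext_insert: "ext G r l B H N \<Longrightarrow> valid G r l (H \<union> N) (w, k, Z, Y) \<Longrightarrow> w \<in> B \<Longrightarrow>
    ext G r l B H (insert (w, k, Z, Y) N)"

lemma ext_good: "ext G r l B H N \<Longrightarrow> good G r l H \<Longrightarrow> good G r l (H \<union> N)"
  by (induction rule: ext.induct) (auto intro: good_insert)

lemma ext_finite: "ext G r l B H N \<Longrightarrow> finite N"
  by (induction rule: ext.induct) auto

lemma ext_centre: "ext G r l B H N \<Longrightarrow> (w, k, Z, Y) \<in> N \<Longrightarrow> w \<in> B"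
  by (induction rule: ext.induct) auto

text \<open>This makes outputs final: the \<open>r\<close>-ball of a processed node is covered, so
  no later core meets it.\<close>

lemma ext_uncovered:
  assumes G: "simple_graph G"
  shows "ext G r l B H N \<Longrightarrow> (w, k, Z, Y) \<in> N \<Longrightarrow> z \<in> Z \<Longrightarrow> \<not> covered H z"
proof (induction rule: ext.induct)
  case (ext_insert N w' k' Z' Y')
  show ?case
  proof (cases "(w, k, Z, Y) = (w', k', Z', Y')")
    case True
    then have "free (H \<union> N) k z"
      using valid_uncovered[OF G ext_insert.hyps(2), of z] ext_insert.prems(2) by simp
    then show ?thesis using covered_mono[of H z "H \<union> N"] unfolding free_def by blast
  next
    case False
    then show ?thesis using ext_insert by auto
  qed
qed simp

text \<open>A core is added around an uncovered node of \<open>B\<close> as long as there is one;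
  its centre becomes covered, so this ends.\<close>

lemma ext_exists:
  assumes G: "simple_graph G" and l: "card (verts G) < 2 ^ Suc l" and H: "good G r l H" and B: "B \<subseteq> verts G"
  shows "\<exists>N. ext G r l B H N \<and> (\<forall>u\<in>B. covered (H \<union> N) u)"
proof -
  have finB: "finite B" using B G finite_subset by (auto simp: simple_graph_def)
  have "\<exists>N'. ext G r l B H N' \<and> (\<forall>u\<in>B. covered (H \<union> N') u)" if "ext G r l B H N" for N
    using that
  proof (induction "card {u \<in> B. \<not> covered (H \<union> N) u}" arbitrary: N rule: less_induct)
    case less
    show ?case
    proof (cases "\<forall>u\<in>B. covered (H \<union> N) u")
      case True
      then show ?thesis using less.prems by blast
    next
      case False
      then obtain w where w: "w \<in> B" "\<not> covered (H \<union> N) w" by blast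
      have "w \<in> verts G" using B w(1) by blast
      from valid_exists[OF G ext_good[OF less.prems H] l this w(2)]
      obtain k Z Y where v: "valid G r l (H \<union> N) (w, k, Z, Y)" by blast
      let ?N = "insert (w, k, Z, Y) N"
      have e: "ext G r l B H ?N" by (rule ext_insert[OF less.prems v w(1)])
      have "w \<in> Z" using valid_well_formed[OF G v] by (simp add: well_formed_def)
      then have cw: "covered (H \<union> ?N) w" unfolding covered_def by blast
      have "{u \<in> B. \<not> covered (H \<union> ?N) u} \<subset> {u \<in> B. \<not> covered (H \<union> N) u}"
        using w cw covered_mono[of "H \<union> N" _ "H \<union> ?N"] by blast
      then have "card {u \<in> B. \<not> covered (H \<union> ?N) u} < card {u \<in> B. \<not> covered (H \<union> N) u}"
        using finB by (intro psubset_card_mono) auto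
      from less.hyps[OF this e] show ?thesis .
    qed
  qed
  from this[OF ext_empty] show ?thesis .
qed

text \<open>A centre is within \<open>r\<close> of the node being processed. From there at most
  \<open>l\<close> growth steps of length 2\<open>r\<close> lead to the core and one more to the
  nodes that it blocks.\<close>

definition reach :: "nat \<Rightarrow> nat \<Rightarrow> nat" where
  "reach r l = r + Suc l * (2 * r)"

text \<open>Growth and validity depend on the existing cores only through these two notions.\<close>

definition same_on :: "nat set \<Rightarrow> core set \<Rightarrow> core set \<Rightarrow> bool" where
  "same_on X H H' \<longleftrightarrow> (\<forall>u\<in>X. (covered H u \<longleftrightarrow> covered H' u) \<and> blocked H u = blocked H' u)"

lemma same_on_Un: "same_on X H H' \<Longrightarrow> same_on X (H \<union> N) (H' \<union> N)"
proof -
  have "covered (A \<union> N) u \<longleftrightarrow> covered A u \<or> covered N u" "blocked (A \<union> N) u = blocked A u \<union> blocked N u" for A u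
    unfolding covered_def blocked_def by blast+
  then show "same_on X H H' \<Longrightarrow> same_on X (H \<union> N) (H' \<union> N)" by (simp add: same_on_def)
qed

context
  fixes G G' :: graph and r l T v :: nat
  assumes G: "simple_graph G" "simple_graph G'" "v \<in> verts G" "agree T v G G'" and T: "reach r l \<le> T"
begin

text \<open>The layers up to \<open>Suc l\<close> stay within \<open>reach r l\<close> of
  \<open>v\<close>, where the graphs and the states of the nodes coincide.\<close>

lemma grow_cong:
  assumes w: "w \<in> hop_ball G r v" and H: "same_on (hop_ball G (reach r l) v) H H'"
  shows "j \<le> Suc l \<Longrightarrow> grow G r H k w j = grow G' r H' k w j \<and> grow G r H k w j \<subseteq> hop_ball G (r + j * (2 * r)) v"
proof (induction j)
  case 0
  then show ?case using w by simp
next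
  case (Suc j)
  then have IH: "grow G r H k w j = grow G' r H' k w j" "grow G r H k w j \<subseteq> hop_ball G (r + j * (2 * r)) v" by auto
  have jl: "Suc j * (2 * r) \<le> Suc l * (2 * r)" using Suc.prems by (rule mult_le_mono1)
  have le: "r + j * (2 * r) + 2 * r \<le> reach r l" using jl by (simp add: reach_def)
  have nz: "near G (2 * r) z u \<longleftrightarrow> near G' (2 * r) z u" if "z \<in> grow G r H k w j" for z u
    by (rule agree_near[OF G, of "r + j * (2 * r)"]) (use that IH(2) le T in \<open>auto simp: hop_ball_near\<close>)
  have ball: "u \<in> verts G \<and> near G (r + Suc j * (2 * r)) v u \<and> u \<in> hop_ball G (reach r l) v \<and> u \<in> verts G'"
    if "z \<in> grow G r H k w j" "near G (2 * r) z u" for z u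
  proof -
    have z: "z \<in> verts G" "near G (r + j * (2 * r)) v z" using that(1) IH(2) by (auto simp: hop_ball_near)
    have u: "u \<in> verts G" using near_verts[OF G(1) that(2)] z(1) by simp
    have vu: "near G (r + j * (2 * r) + 2 * r) v u" using near_trans[OF z(2) that(2)] .
    then have "u \<in> hop_ball G (reach r l) v" using u near_mono[OF vu le] by (simp add: hop_ball_near)
    moreover from this have "u \<in> hop_ball G T v" using hop_ball_mono[OF T] by blast
    then have "u \<in> verts G'" by (rule agree_verts[OF G(4)])
    ultimately show ?thesis using u vu by (simp add: add.assoc add.commute)
  qed
  have fr: "free H k u \<longleftrightarrow> free H' k u" if "u \<in> hop_ball G (reach r l) v" for u
    using H that by (simp add: same_on_def free_def)
  have "u \<in> grow G r H k w (Suc j) \<longleftrightarrow> u \<in> grow G' r H' k w (Suc j)" for u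
    unfolding grow.simps IH(1)[symmetric] using nz ball fr by blast
  moreover have "grow G r H k w (Suc j) \<subseteq> hop_ball G (r + Suc j * (2 * r)) v"
    unfolding grow.simps hop_ball_near using ball by blast
  ultimately show ?case by blast
qed

lemma valid_cong:
  assumes w: "w \<in> hop_ball G r v" and H: "same_on (hop_ball G (reach r l) v) H H'"
  shows "valid G r l H (w, k, Z, Y) \<longleftrightarrow> valid G' r l H' (w, k, Z, Y)"
proof -
  let ?B = "hop_ball G (reach r l) v"
  have rr: "r \<le> reach r l" by (simp add: reach_def)
  then have wB: "w \<in> ?B" using w hop_ball_mono by blast
  then have "w \<in> verts G'" using agree_verts[OF G(4)] hop_ball_mono[OF T] by blast
  then have 1: "w \<in> verts G \<longleftrightarrow> w \<in> verts G'" using w by (simp add: hop_ball_near)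
  have 2: "free H k w \<longleftrightarrow> free H' k w" using H wB by (simp add: same_on_def free_def)
  have gB: "grow G r H k w j \<subseteq> ?B" if "j \<le> Suc l" for j
  proof -
    have "r + j * (2 * r) \<le> reach r l" unfolding reach_def by (intro add_left_mono mult_le_mono1 that)
    then show ?thesis using grow_cong[OF w H that, of k] hop_ball_mono by blast
  qed
  have sums: "sum (weight H) A = sum (weight H') A" if "A \<subseteq> ?B" for A
    by (rule sum.cong) (use H that in \<open>auto simp: same_on_def weight_def\<close>)
  have 3: "(Z = grow G r H k w j \<and> Y = grow G r H k w (Suc j) - Z \<and> sum (weight H) Y \<le> sum (weight H) Z) \<longleftrightarrow>
      (Z = grow G' r H' k w j \<and> Y = grow G' r H' k w (Suc j) - Z \<and> sum (weight H') Y \<le> sum (weight H') Z)"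
    if "j \<le> l" for j
  proof -
    have j: "j \<le> Suc l" "Suc j \<le> Suc l" using that by auto
    note e = grow_cong[OF w H j(1), of k, THEN conjunct1] grow_cong[OF w H j(2), of k, THEN conjunct1]
    have "sum (weight H) Y = sum (weight H') Y \<and> sum (weight H) Z = sum (weight H') Z"
      if "Z = grow G r H k w j" "Y = grow G r H k w (Suc j) - Z"
      using sums[of Y] sums[of Z] gB[OF j(1)] gB[OF j(2)] that by blast
    then show ?thesis unfolding e[symmetric] by auto
  qed
  have "(\<exists>j\<le>l. Z = grow G r H k w j \<and> Y = grow G r H k w (Suc j) - Z \<and> sum (weight H) Y \<le> sum (weight H) Z) \<longleftrightarrow>
      (\<exists>j\<le>l. Z = grow G' r H' k w j \<and> Y = grow G' r H' k w (Suc j) - Z \<and> sum (weight H') Y \<le> sum (weight H') Z)"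
    by (rule ex_cong1) (rule conj_cong[OF refl 3])
  then show ?thesis unfolding valid_def prod.case 1 2 by (rule arg_cong)
qed

lemma ext_cong:
  assumes H: "same_on (hop_ball G (reach r l) v) H H'"
  shows "ext G r l (hop_ball G r v) H N \<longleftrightarrow> ext G' r l (hop_ball G r v) H' N"
proof
  show "ext G r l (hop_ball G r v) H N \<Longrightarrow> ext G' r l (hop_ball G r v) H' N"
  proof (induction rule: ext.induct)
    case (ext_insert N w k Z Y)
    then show ?case using valid_cong[OF ext_insert.hyps(3) same_on_Un[OF H]] by (intro ext.ext_insert) blast+
  qed (rule ext_empty)
  show "ext G' r l (hop_ball G r v) H' N \<Longrightarrow> ext G r l (hop_ball G r v) H N"
  proof (induction rule: ext.induct)
    case (ext_insert N w k Z Y)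
    then show ?case using valid_cong[OF ext_insert.hyps(3) same_on_Un[OF H]] by (intro ext.ext_insert) blast+
  qed (rule ext_empty)
qed

end

section \<open>Storing cores and the SLOCAL algorithm\<close>

definition core_encode :: "core \<Rightarrow> nat" where
  "core_encode = (\<lambda>(w, k, Z, Y). prod_encode (w, prod_encode (k, prod_encode (set_encode Z, set_encode Y))))"

definition core_decode :: "nat \<Rightarrow> core" where
  "core_decode s = (let (w, s1) = prod_decode s; (k, s2) = prod_decode s1; (z, y) = prod_decode s2
     in (w, k, set_decode z, set_decode y))"

definition cores_decode :: "nat \<Rightarrow> core set" where
  "cores_decode s = core_decode ` set_decode s"

lemma cores_inverse:
  assumes "finite N" "\<And>w k Z Y. (w, k, Z, Y) \<in> N \<Longrightarrow> finite Z \<and> finite Y"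
  shows "cores_decode (set_encode (core_encode ` N)) = N"
proof -
  have "core_decode (core_encode c) = c" if "c \<in> N" for c
    using assms(2) that by (cases c) (auto simp: core_encode_def core_decode_def Let_def)
  then show ?thesis using assms(1) by (simp add: cores_decode_def image_image)
qed

definition stored_cores :: "nat option set \<Rightarrow> core set" where
  "stored_cores X = (\<Union>m\<in>{m. Some m \<in> X}. cores_decode (snd (prod_decode m)))"

text \<open>Clusters are named after the centres of their cores. If \<open>B\<close> is the
  \<open>r\<close>-ball of a node, these are the names of the clusters containing the node.\<close>

definition touching :: "core set \<Rightarrow> nat set \<Rightarrow> nat set" where
  "touching H B = {w. \<exists>k Z Y. (w, k, Z, Y) \<in> H \<and> Z \<inter> B \<noteq> {}}"

text \<open>Local computations are unrestricted, so an arbitrary but fixed choice is allowed; it is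
  made from the graph and the cores that are visible to the node.\<close>

definition new_cores :: "nat \<Rightarrow> nat \<Rightarrow> graph \<Rightarrow> nat \<Rightarrow> core set \<Rightarrow> core set" where
  "new_cores r l G i H = (SOME N. ext G r l (hop_ball G r i) H N \<and> (\<forall>u\<in>hop_ball G r i. covered (H \<union> N) u))"

definition cover_store :: "(nat \<Rightarrow> nat) \<Rightarrow> nat \<Rightarrow> view \<Rightarrow> nat" where
  "cover_store r n = (\<lambda>(i, S, E).
     let G = \<lparr>verts = fst ` S, edges = E\<rparr>; H = stored_cores ((\<lambda>(u, x, m). m) ` S);
         N = new_cores (r n) (floor_log n) G i H
     in prod_encode (set_encode (touching (H \<union> N) (hop_ball G (r n) i)), set_encode (core_encode ` N)))"

definition cover_alg :: "(nat \<Rightarrow> nat) \<Rightarrow> slocal_alg" where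
  "cover_alg r = \<lparr>s_store = cover_store r, s_output = (\<lambda>s. fst (prod_decode s))\<rparr>"

definition own_cores :: "(nat \<rightharpoonup> nat) \<Rightarrow> nat \<Rightarrow> core set" where
  "own_cores mem u = stored_cores {mem u}"

definition all_cores :: "(nat \<rightharpoonup> nat) \<Rightarrow> core set" where
  "all_cores mem = (\<Union>u. own_cores mem u)"

lemma own_cores_None [simp]: "mem u = None \<Longrightarrow> own_cores mem u = {}"
  by (simp add: own_cores_def stored_cores_def)

lemma stored_cores_image: "stored_cores (mem ` X) = (\<Union>u\<in>X. own_cores mem u)"
  unfolding stored_cores_def own_cores_def by (auto simp: image_iff)

context
  fixes G :: graph and r :: "nat \<Rightarrow> nat" and n l P T :: nat and x :: labelling
  assumes G: "simple_graph G" and n: "card (verts G) = n"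
  defines "l \<equiv> floor_log n" and "P \<equiv> reach (r n) l" and "T \<equiv> 2 * P"
begin

text \<open>For processed nodes, the covered balls keep the outputs final, and the bound
  \<open>P\<close> on the distance to their own cores makes these cores visible to nodes that are
  processed later.\<close>

definition invariant :: "nat set \<Rightarrow> (nat \<rightharpoonup> nat) \<Rightarrow> bool" where
  "invariant X mem \<longleftrightarrow> good G (r n) l (all_cores mem) \<and>
     (\<forall>u. u \<notin> X \<longrightarrow> mem u = None) \<and>
     (\<forall>u\<in>X. (\<forall>w\<in>hop_ball G (r n) u. covered (all_cores mem) w) \<and>
        (\<forall>w k Z Y z. (w, k, Z, Y) \<in> own_cores mem u \<longrightarrow> z \<in> Z \<union> Y \<longrightarrow> near G P u z) \<and>
        set_decode (fst (prod_decode (the (mem u)))) = touching (all_cores mem) (hop_ball G (r n) u))"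

lemma invariant_step:
  assumes inv: "invariant X mem" and X: "X \<subseteq> verts G" and v: "v \<in> verts G" "v \<notin> X"
  shows "invariant (insert v X) (slocal_step (cover_alg r) n T G id x mem v)"
proof -
  let ?r = "r n" let ?B = "hop_ball G T v" let ?b = "hop_ball G ?r v"
  \<comment> \<open>\<open>G'\<close> and \<open>H'\<close> are the part of the graph and the cores
    that \<open>v\<close> reads; \<open>H\<close> consists of all cores.\<close>
  define G' where "G' = \<lparr>verts = ?B, edges = edges (induced G ?B)\<rparr>"
  define H where "H = all_cores mem"
  define H' where "H' = (\<Union>u\<in>?B. own_cores mem u)"
  define N where "N = new_cores ?r l G' v H'"
  note inv = inv[unfolded invariant_def, folded H_def]
  note unprocessed = inv[THEN conjunct2, THEN conjunct1, rule_format]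
  note processed = inv[THEN conjunct2, THEN conjunct2, THEN bspec]
  have good: "good G ?r l H" using inv by (rule conjunct1)
  have memv: "mem v = None" by (rule unprocessed[OF v(2)])
  have cov: "covered H w" if "u \<in> X" "w \<in> hop_ball G ?r u" for u w
    using processed[OF that(1), THEN conjunct1] that(2) by (rule bspec)
  have own_near: "near G P u z" if "u \<in> X" "(w, k, Z, Y) \<in> own_cores mem u" "z \<in> Z \<union> Y" for u w k Z Y z
    using processed[OF that(1), THEN conjunct2, THEN conjunct1, rule_format, OF that(2,3)] .
  have outs: "set_decode (fst (prod_decode (the (mem u)))) = touching H (hop_ball G ?r u)" if "u \<in> X" for u
    using processed[OF that] by simp
  have nl: "card (verts G) < 2 ^ Suc l" unfolding n l_def using floor_log_exp2_gt[of n] by simp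
  have PT: "P \<le> T" by (simp add: T_def)
  have rP: "?r \<le> P" by (simp add: P_def reach_def)
  have sG': "simple_graph G'"
    using G finite_hop_ball[OF G] by (auto simp: simple_graph_def G'_def induced_def)
  have agr: "agree T v G G'"
    by (rule agreeI[OF _ _ _ G v(1)]) (auto simp: G'_def induced_def hop_ball_near)
  have b': "hop_ball G' ?r v = ?b"
    by (rule agree_hop_ball[OF G sG' v(1) agr near_refl[of G 0], symmetric]) (use rP PT in simp)
  have bP: "?b \<subseteq> hop_ball G P v" using rP by (rule hop_ball_mono)
  have H'H: "H' \<subseteq> H" by (auto simp: H'_def H_def all_cores_def)
  \<comment> \<open>This is the reason for the locality 2\<open>P\<close>: a core that matters to a
    node within \<open>P\<close> of \<open>v\<close> is stored within \<open>P\<close> of that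
    node.\<close>
  have vis: "(w, k, Z, Y) \<in> H'" if c: "(w, k, Z, Y) \<in> H" "z \<in> Z \<union> Y" "near G P v z" for w k Z Y z
  proof -
    obtain u where u: "(w, k, Z, Y) \<in> own_cores mem u" using c(1) by (auto simp: H_def all_cores_def)
    then have "mem u \<noteq> None" by (metis own_cores_None empty_iff)
    then have uX: "u \<in> X" using unprocessed by metis
    then have "near G P u z" using own_near[OF _ u c(2)] by simp
    then have "near G (P + P) v u" using near_trans[OF c(3) near_sym] by blast
    then have "u \<in> ?B" using X uX by (auto simp: hop_ball_near T_def mult_2)
    then show ?thesis using u by (auto simp: H'_def)
  qed
  have same: "same_on (hop_ball G P v) H H'"
    unfolding same_on_def
  proof (intro ballI conjI)
    fix u assume "u \<in> hop_ball G P v"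
    then have u: "near G P v u" by (simp add: hop_ball_near)
    show "covered H u \<longleftrightarrow> covered H' u"
      using vis[OF _ _ u] covered_mono[OF _ H'H] unfolding covered_def by blast
    show "blocked H u = blocked H' u"
      using vis[OF _ _ u] blocked_mono[OF H'H, of u] unfolding blocked_def by blast
  qed
  \<comment> \<open>The cores chosen from the visible information are therefore a correct choice for
    the whole graph.\<close>
  have ext_eq: "ext G ?r l ?b H M \<longleftrightarrow> ext G' ?r l ?b H' M" for M
    by (rule ext_cong[OF G sG' v(1) agr]) (use same PT in \<open>simp_all add: P_def\<close>)
  have cov_eq: "(\<forall>u\<in>?b. covered (H \<union> M) u) \<longleftrightarrow> (\<forall>u\<in>?b. covered (H' \<union> M) u)" for M
    using same_on_Un[OF same, of M] bP unfolding same_on_def by blast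
  have "\<exists>M. ext G' ?r l ?b H' M \<and> (\<forall>u\<in>?b. covered (H' \<union> M) u)"
    using ext_exists[OF G nl good, of ?b] unfolding ext_eq cov_eq by (simp add: hop_ball_near)
  then have "ext G' ?r l ?b H' N \<and> (\<forall>u\<in>?b. covered (H' \<union> N) u)"
    unfolding N_def new_cores_def b' by (rule someI_ex)
  then have N: "ext G ?r l ?b H N" "\<forall>u\<in>?b. covered (H \<union> N) u"
    unfolding ext_eq cov_eq by blast+
  have goodN: "good G ?r l (H \<union> N)" by (rule ext_good[OF N(1) good])
  have finV: "finite (verts G)" using G by (simp add: simple_graph_def)
  have wf: "well_formed G ?r l c" if "c \<in> H \<union> N" for c by (rule good_well_formed[OF G goodN that])
  have finN: "cores_decode (set_encode (core_encode ` N)) = N"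
  proof (rule cores_inverse[OF ext_finite[OF N(1)]])
    fix w k Z Y assume "(w, k, Z, Y) \<in> N"
    then have "Z \<subseteq> verts G" "Y \<subseteq> verts G" using wf[of "(w, k, Z, Y)"] by (simp_all add: well_formed_def)
    then show "finite Z \<and> finite Y" using finV finite_subset by blast
  qed
  define out where "out = touching (H' \<union> N) ?b"
  have out: "out = touching (H \<union> N) ?b"
  proof -
    have "(w, k, Z, Y) \<in> H'" if "(w, k, Z, Y) \<in> H" "z \<in> Z" "z \<in> ?b" for w k Z Y z
      using vis[OF that(1), of z] that(2,3) bP by (auto simp: hop_ball_near)
    then show ?thesis unfolding out_def touching_def using H'H by blast
  qed
  have fout: "finite out"
    unfolding out
  proof (rule finite_subset)
    show "touching (H \<union> N) ?b \<subseteq> fst ` (H \<union> N)" unfolding touching_def by force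
    show "finite (fst ` (H \<union> N))" using good_finite[OF G goodN] by simp
  qed
  have view: "slocal_view T G id x mem v = (v, (\<lambda>u. (u, x u, mem u)) ` ?B, edges (induced G ?B))"
    by (simp add: slocal_view_def)
  have "s_store (cover_alg r) n (slocal_view T G id x mem v) =
      prod_encode (set_encode out, set_encode (core_encode ` N))"
  proof -
    have 1: "\<lparr>verts = fst ` (\<lambda>u. (u, x u, mem u)) ` ?B, edges = edges (induced G ?B)\<rparr> = G'"
      by (simp add: G'_def image_image)
    have 2: "stored_cores ((\<lambda>(u, x, m). m) ` (\<lambda>u. (u, x u, mem u)) ` ?B) = H'"
      unfolding image_image H'_def stored_cores_image[symmetric] by simp
    show ?thesis
      unfolding view cover_alg_def cover_store_def slocal_alg.simps prod.case Let_def 1 2 l_def[symmetric]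
        N_def[symmetric] b' out_def ..
  qed
  then have mem': "slocal_step (cover_alg r) n T G id x mem v =
      mem(v \<mapsto> prod_encode (set_encode out, set_encode (core_encode ` N)))" (is "_ = ?mem")
    by (simp add: slocal_step_def)
  have own: "own_cores ?mem u = (if u = v then N else own_cores mem u)" for u
    using finN by (simp add: own_cores_def stored_cores_def)
  have all: "all_cores ?mem = H \<union> N"
  proof -
    have "all_cores ?mem = (\<Union>u. if u = v then N else own_cores mem u)" unfolding all_cores_def own ..
    also have "\<dots> = H \<union> N" using own_cores_None[of mem v, OF memv]
      by (auto simp: H_def all_cores_def split: if_splits)
    finally show ?thesis .
  qed
  have old: "touching (H \<union> N) (hop_ball G ?r u) = touching H (hop_ball G ?r u)" if "u \<in> X" for u
  proof -
    have "Z \<inter> hop_ball G ?r u = {}" if "(w, k, Z, Y) \<in> N" for w k Z Y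
      
      using ext_uncovered[OF G N(1) that] cov[OF \<open>u \<in> X\<close>] by blast
    then show ?thesis unfolding touching_def by blast
  qed
  have nearN: "near G P v z" if c: "(w, k, Z, Y) \<in> N" and z: "z \<in> Z \<union> Y" for w k Z Y z
  proof -
    have "near G (Suc l * (2 * ?r)) w z" using wf[of "(w, k, Z, Y)"] c z unfolding well_formed_def by blast
    moreover have "near G ?r v w" using ext_centre[OF N(1) c] by (simp add: hop_ball_near)
    ultimately show ?thesis unfolding P_def reach_def by (rule near_trans[rotated])
  qed
  show ?thesis
    unfolding mem' invariant_def all
  proof (intro conjI ballI allI impI)
    show "good G ?r l (H \<union> N)" by (rule goodN)
    fix u assume "u \<notin> insert v X"
    then show "?mem u = None" using unprocessed by simp
  next
    fix u w assume "u \<in> insert v X" "w \<in> hop_ball G ?r u"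
    then show "covered (H \<union> N) w"
      using N(2) cov[of u w] covered_mono[of H w "H \<union> N"] by blast
  next
    fix u w k Z Y z assume "u \<in> insert v X" "(w, k, Z, Y) \<in> own_cores ?mem u" "z \<in> Z \<union> Y"
    then show "near G P u z" using nearN own_near unfolding own by (metis insertE)
  next
    fix u assume u: "u \<in> insert v X"
    show "set_decode (fst (prod_decode (the (?mem u)))) = touching (H \<union> N) (hop_ball G ?r u)"
    proof (cases "u = v")
      case True
      then show ?thesis using fout out by simp
    next
      case False
      then have "u \<in> X" using u by simp
      then show ?thesis using False outs old by simp
    qed
  qed
qed

lemma invariant_run:
  "distinct vs \<Longrightarrow> set vs \<subseteq> verts G \<Longrightarrow> invariant (set vs) (slocal_run (cover_alg r) n T G id x vs)"
proof (induction vs rule: rev_induct)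
  case Nil
  then show ?case by (simp add: invariant_def all_cores_def good_empty)
next
  case (snoc v vs)
  have "invariant (insert v (set vs)) (slocal_step (cover_alg r) n T G id x (slocal_run (cover_alg r) n T G id x vs) v)"
    by (rule invariant_step[OF snoc.IH]) (use snoc.prems in simp_all)
  then show ?case unfolding slocal_run_snoc by simp
qed

lemma cover_alg_outputs:
  assumes "distinct vs" "set vs = verts G"
  obtains H where "good G (r n) l H" "\<And>u. u \<in> verts G \<Longrightarrow> covered H u"
    "\<And>u. u \<in> verts G \<Longrightarrow>
      set_decode (s_output (cover_alg r) (the (slocal_run (cover_alg r) n T G id x vs u))) = touching H (hop_ball G (r n) u)"
proof -
  let ?mem = "slocal_run (cover_alg r) n T G id x vs"
  have inv: "invariant (verts G) ?mem" by (rule invariant_run[OF assms(1), unfolded assms(2), OF order_refl])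
  show thesis
  proof (rule that[of "all_cores ?mem"])
    show "good G (r n) l (all_cores ?mem)" using inv by (simp only: invariant_def)
    fix u assume u: "u \<in> verts G"
    note p = inv[unfolded invariant_def, THEN conjunct2, THEN conjunct2, THEN bspec, OF u]
    show "covered (all_cores ?mem) u" using p[THEN conjunct1] self_in_hop_ball[OF u] by (rule bspec)
    show "set_decode (s_output (cover_alg r) (the (?mem u))) = touching (all_cores ?mem) (hop_ball G (r n) u)"
      using p by (simp add: cover_alg_def)
  qed
qed

end


section \<open>From good sets of cores to neighborhood covers\<close>

lemma diameter_le_iff: "diameter G \<le> enat D \<longleftrightarrow> (\<forall>u\<in>verts G. \<forall>v\<in>verts G. near G D u v)"
  by (simp add: diameter_def SUP_le_iff near_def)

text \<open>The clusters are the expansions of the cores. Each node of a cluster is within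
  2\<open>l\<close> \<open>r\<close> + \<open>r\<close> of the centre, which gives the diameter. A
  node in two clusters of the same colour would bring their cores within 2\<open>r\<close> of each
  other, which gives the overlap.\<close>

lemma good_cover:
  assumes G: "simple_graph G" and H: "good G r l H" and cov: "\<And>u. u \<in> verts G \<Longrightarrow> covered H u"
  shows "neighborhood_cover G r (r * (4 * l + 2)) (Suc l) (\<Union>v\<in>verts G. touching H (hop_ball G r v))
    (\<lambda>j. {v \<in> verts G. j \<in> touching H (hop_ball G r v)})"
proof -
  let ?J = "\<Union>v\<in>verts G. touching H (hop_ball G r v)"
  let ?C = "\<lambda>j. {v \<in> verts G. j \<in> touching H (hop_ball G r v)}"
  have wf: "w \<in> Z \<and> w \<in> verts G \<and> k \<le> l \<and> Z \<subseteq> verts G \<and>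
     (\<forall>z\<in>Z. near (induced G (expansion G r Z)) (l * (2 * r)) w z)" if "(w, k, Z, Y) \<in> H" for w k Z Y
    using good_well_formed[OF G H that] by (simp add: well_formed_def)
  \<comment> \<open>A centre lies in its own core and distinct cores are disjoint, so a name
    determines its core.\<close>
  have uniq: "(w, k, Z, Y) = (w, k', Z', Y')" if "(w, k, Z, Y) \<in> H" "(w, k', Z', Y') \<in> H" for w k Z Y k' Z' Y'
    using good_separated[OF G H that, of w w] wf[OF that(1)] wf[OF that(2)] by blast
  have C: "?C w = expansion G r Z" if c: "(w, k, Z, Y) \<in> H" for w k Z Y
  proof -
    have "w \<in> touching H (hop_ball G r v) \<longleftrightarrow> (\<exists>z\<in>Z. near G r z v)" for v
    proof
      assume "w \<in> touching H (hop_ball G r v)"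
      then obtain k' Z' Y' where c': "(w, k', Z', Y') \<in> H" "Z' \<inter> hop_ball G r v \<noteq> {}"
        unfolding touching_def by blast
      with uniq[OF c c'(1)] show "\<exists>z\<in>Z. near G r z v" using near_sym[of G r v] by (auto simp: hop_ball_near)
    next
      assume "\<exists>z\<in>Z. near G r z v"
      then have "Z \<inter> hop_ball G r v \<noteq> {}" using wf[OF c] near_sym[of G r _ v] by (auto simp: hop_ball_near)
      then show "w \<in> touching H (hop_ball G r v)" using c unfolding touching_def by blast
    qed
    then show ?thesis by (simp add: expansion_def)
  qed
  have centre: "\<exists>k Z Y. (j, k, Z, Y) \<in> H" if "j \<in> ?J" for j using that unfolding touching_def by blast
  have "finite ?J"
  proof (rule finite_subset)
    show "?J \<subseteq> fst ` H" using centre by force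
    show "finite (fst ` H)" using good_finite[OF G H] by simp
  qed
  moreover have "diameter (induced G (?C j)) \<le> enat (r * (4 * l + 2))" if j: "j \<in> ?J" for j
  proof -
    obtain k Z Y where c: "(j, k, Z, Y) \<in> H" using centre[OF j] by blast
    let ?I = "induced G (expansion G r Z)"
    have arm: "near ?I (l * (2 * r) + r) j u" if u: "u \<in> expansion G r Z" for u
    proof -
      obtain z where z: "z \<in> Z" "near G r z u" using u by (auto simp: expansion_def)
      have "z \<in> verts G" using wf[OF c] z(1) by blast
      then have "near ?I r z u" using near_expansion[OF G z(1) _ order_refl z(2)] by simp
      moreover have "near ?I (l * (2 * r)) j z" using wf[OF c] z(1) by blast
      ultimately show ?thesis by (rule near_trans[rotated])
    qed
    have "near ?I (r * (4 * l + 2)) u v" if "u \<in> expansion G r Z" "v \<in> expansion G r Z" for u v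
      using near_trans[OF near_sym[OF arm[OF that(1)]] arm[OF that(2)]]
      by (rule near_mono) (simp add: algebra_simps)
    then show ?thesis unfolding C[OF c] diameter_le_iff by (simp add: induced_def)
  qed
  moreover have "\<exists>j\<in>?J. hop_ball G r v \<subseteq> ?C j" if v: "v \<in> verts G" for v
  proof -
    obtain w k Z Y where c: "(w, k, Z, Y) \<in> H" "v \<in> Z" using cov[OF v] unfolding covered_def by blast
    have sub: "hop_ball G r v \<subseteq> ?C w" unfolding C[OF c(1)] using c(2) by (auto simp: hop_ball_near expansion_def)
    moreover have "w \<in> ?J" using sub self_in_hop_ball[OF v, of r] by blast
    ultimately show ?thesis by blast
  qed
  moreover have "card {j \<in> ?J. v \<in> ?C j} \<le> Suc l" if v: "v \<in> verts G" for v
  proof -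
    \<comment> \<open>The clusters containing \<open>v\<close> are counted by mapping each to the
      colour of its core, injectively by \<open>good_separated\<close>; there are
      \<open>Suc l\<close> colours.\<close>
    define col where "col j = (SOME k. \<exists>Z Y. (j, k, Z, Y) \<in> H \<and> Z \<inter> hop_ball G r v \<noteq> {})" for j
    have col: "\<exists>Z Y. (j, col j, Z, Y) \<in> H \<and> Z \<inter> hop_ball G r v \<noteq> {}" if "j \<in> touching H (hop_ball G r v)" for j
    proof -
      have "\<exists>k Z Y. (j, k, Z, Y) \<in> H \<and> Z \<inter> hop_ball G r v \<noteq> {}" using that unfolding touching_def by blast
      then show ?thesis unfolding col_def by (rule someI_ex)
    qed
    have "card {j \<in> ?J. v \<in> ?C j} \<le> card {..l}"
    proof (rule card_inj_on_le[of col])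
      show "inj_on col {j \<in> ?J. v \<in> ?C j}"
      proof (rule inj_onI)
        fix i j assume ij: "i \<in> {j \<in> ?J. v \<in> ?C j}" "j \<in> {j \<in> ?J. v \<in> ?C j}" "col i = col j"
        then have "i \<in> touching H (hop_ball G r v)" "j \<in> touching H (hop_ball G r v)" by blast+
        then obtain Z Y Z' Y' z z' where c: "(i, col i, Z, Y) \<in> H" "(j, col j, Z', Y') \<in> H"
          "z \<in> Z" "z' \<in> Z'" "near G r v z" "near G r v z'"
          using col[of i] col[of j] by (auto simp: hop_ball_near)
        have "near G (2 * r) z z'" using near_trans[OF near_sym[OF c(5)] c(6)] by (simp add: mult_2)
        then show "i = j" using good_separated[OF G H c(1,2) _ c(3,4)] ij(3) by auto
      qed
      show "col ` {j \<in> ?J. v \<in> ?C j} \<subseteq> {..l}" using col wf by fastforce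
    qed simp
    then show ?thesis by simp
  qed
  ultimately show ?thesis unfolding neighborhood_cover_def by blast
qed

lemma neighborhood_cover_relabel:
  assumes G: "simple_graph G" and inj: "inj_on ident (verts G)"
    and cover: "neighborhood_cover (relabel ident G) r D s J C"
  shows "neighborhood_cover G r D s J (\<lambda>j. {v \<in> verts G. ident v \<in> C j})"
proof -
  let ?H = "relabel ident G" and ?C = "\<lambda>j. {v \<in> verts G. ident v \<in> C j}"
  have "diameter (induced G (?C j)) \<le> enat D" if j: "j \<in> J" for j
  proof -
    have CV: "C j \<subseteq> ident ` verts G" and dm: "diameter (induced ?H (C j)) \<le> enat D"
      using cover j unfolding neighborhood_cover_def by auto
    let ?I = "induced G (?C j)"
    have sI: "simple_graph ?I" using G by (auto simp: simple_graph_def induced_def)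
    have iI: "inj_on ident (verts ?I)" by (rule inj_on_subset[OF inj]) (auto simp: induced_def)
    have "relabel ident ?I = induced ?H (C j)"
    proof -
      \<comment> \<open>Relabelling commutes with taking induced subgraphs, so the diameters of the
        clusters are preserved.\<close>
      have "e \<subseteq> ?C j \<longleftrightarrow> ident ` e \<subseteq> C j" if "e \<in> edges G" for e
        using G that unfolding simple_graph_def by blast
      then have "(`) ident ` edges ?I = edges (induced ?H (C j))" by (auto simp: induced_def)
      moreover have "ident ` verts ?I = verts (induced ?H (C j))" by (auto simp: induced_def)
      moreover have "edges (induced ?H (C j)) = {e \<in> edges ?H. e \<subseteq> C j}" by (simp add: induced_def)
      ultimately show ?thesis unfolding relabel_def[of ident ?I] by (simp add: induced_def)
    qed
    then have "near (relabel ident ?I) D (ident u) (ident v)" if "u \<in> verts ?I" "v \<in> verts ?I" for u v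
      using dm[unfolded diameter_le_iff] that by (auto simp: induced_def)
    then show ?thesis unfolding diameter_le_iff using relabel_near[OF sI iI] by blast
  qed
  moreover have "\<exists>j\<in>J. hop_ball G r v \<subseteq> ?C j" if v: "v \<in> verts G" for v
  proof -
    have "ident v \<in> verts ?H" using v by simp
    then obtain j where "j \<in> J" "hop_ball ?H r (ident v) \<subseteq> C j"
      using cover unfolding neighborhood_cover_def by blast
    then show ?thesis unfolding relabel_hop_ball[OF G inj v] by (auto simp: hop_ball_near)
  qed
  moreover have "card {j \<in> J. v \<in> ?C j} \<le> s" if v: "v \<in> verts G" for v
  proof -
    have "ident v \<in> verts ?H" using v by simp
    then have "card {j \<in> J. ident v \<in> C j} \<le> s" using cover unfolding neighborhood_cover_def by blast
    then show ?thesis using v by simp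
  qed
  ultimately show ?thesis using cover unfolding neighborhood_cover_def by auto
qed

text \<open>The bounds are those of \<open>good_cover\<close> with \<open>l = floor_log n\<close>.
  The algorithm is run on the relabelled graph, where clusters are named by identifiers, and the
  cover is carried back.\<close>

lemma cover_problem_in_P_SLOCAL:
  assumes r: "polylog r"
  shows "cover_problem r (\<lambda>n. 4 * floor_log n + 2) (\<lambda>n. Suc (floor_log n)) \<in> P_SLOCAL"
  unfolding P_SLOCAL_def
proof (intro CollectI allI exI conjI impI)
  let ?t = "\<lambda>n. 2 * reach (r n) (floor_log n)"
  let ?P = "cover_problem r (\<lambda>n. 4 * floor_log n + 2) (\<lambda>n. Suc (floor_log n))"
  show "polylog ?t" unfolding reach_def by (intro polylog_intros r)
  fix c G ident x vs
  assume G: "simple_graph G" and id: "id_assignment c G ident" and vs: "distinct vs" "set vs = verts G"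
  define n where "n = card (verts G)"
  let ?l = "floor_log n"
  let ?H = "relabel ident G" and ?y = "slocal_result (cover_alg r) (?t n) G ident x vs"
  have inj: "inj_on ident (verts G)" using id by (simp add: id_assignment_def)
  note sH = simple_relabel[OF G inj]
  have cH: "card (verts ?H) = n" using card_relabel[OF G inj] by (simp add: n_def)
  have "distinct (map ident vs)" "set (map ident vs) = verts ?H"
    using vs inj by (simp_all add: distinct_map)
  then obtain H where good: "good ?H (r n) ?l H" and cov: "\<And>u. u \<in> verts ?H \<Longrightarrow> covered H u"
    and out: "\<And>u. u \<in> verts ?H \<Longrightarrow> set_decode (s_output (cover_alg r)
        (the (slocal_run (cover_alg r) n (?t n) ?H id (transported G ident x) (map ident vs) u))) =
      touching H (hop_ball ?H (r n) u)"
    by (rule cover_alg_outputs[where r = r and x = "transported G ident x", OF sH cH]) (rule that; blast)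
  have y: "set_decode (?y v) = touching H (hop_ball ?H (r n) (ident v))" if "v \<in> verts G" for v
    using out[of "ident v"] slocal_result_relabel[OF G inj vs(2) that, of "cover_alg r" "?t n" x] that
    by (simp add: n_def)
  have "neighborhood_cover G (r n) (r n * (4 * ?l + 2)) (Suc ?l) (\<Union>v\<in>verts ?H. touching H (hop_ball ?H (r n) v))
    (\<lambda>j. {v \<in> verts G. ident v \<in> {v \<in> verts ?H. j \<in> touching H (hop_ball ?H (r n) v)}})"
    by (rule neighborhood_cover_relabel[OF G inj good_cover[OF sH good cov]])
  moreover have "(\<Union>v\<in>verts ?H. touching H (hop_ball ?H (r n) v)) = (\<Union>v\<in>verts G. set_decode (?y v))"
    using y by simp
  moreover have "(\<lambda>j. {v \<in> verts G. ident v \<in> {v \<in> verts ?H. j \<in> touching H (hop_ball ?H (r n) v)}}) =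
      (\<lambda>j. {v \<in> verts G. j \<in> set_decode (?y v)})"
    using y by auto
  ultimately show "admissible ?P G x (slocal_result (cover_alg r) (?t (card (verts G))) G ident x vs)"
    unfolding cover_problem_def problem.simps Let_def n_def[symmetric] by simp
qed

theorem theorem7p9:
  fixes r :: "nat \<Rightarrow> nat"
  assumes "\<And>n. r n \<ge> 1" and "polylog r"
  shows "P_SLOCAL_complete (sparse_neighborhood_cover r)"
proof -
  have "polylog (\<lambda>n. 4 * floor_log n + 2)" "polylog (\<lambda>n. Suc (floor_log n))"
    by (intro polylog_intros)+
  then have "cover_problem r (\<lambda>n. 4 * floor_log n + 2) (\<lambda>n. Suc (floor_log n)) \<in> sparse_neighborhood_cover r"
    unfolding sparse_neighborhood_cover_def by blast
  then show ?thesis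
    unfolding P_SLOCAL_complete_def
    using cover_problem_in_P_SLOCAL[OF assms(2)] P_SLOCAL_subset_P_LOCAL by blast
qed
end
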